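(* The optimal procedure $\{\boldsymbol\delta^\star_{1:\mathsf T^\star},D^\star_{\mathsf T^\star},\mathsf T^\star\}$ that solves the infinite-horizon Bayes problem $$\min_{\{\boldsymbol\delta_{1:\mathsf T},D_{\mathsf T},\mathsf T\}}\ \mathbb E\Big(\sum_{t=1}^{\mathsf T}\mathcal C_{\delta_t}+\mu_0\mathbb 1_{\{D_{\mathsf T}=1;\,\mathcal H=0\}}+\mu_1\mathbb 1_{\{D_{\mathsf T}=0;\,\mathcal H=1\}}\Big)$$ (no upper bound imposed on $\mathsf T$) features a sequential probability ratio test (SPRT) with stationary sensor selection strategy, i.e.: 1. The optimal sensor selection rule is a time-invariant function of the log-likelihood ratio, i.e. $\delta^\star_{t+1}=\psi(L_t)$. 2. The stopping rule is in the form of the SPRT $\mathsf T^\star=\min\{t:L_t\notin(-A,B)\}$, with constants $A,B$. 3. The optimal decision rule $D^\star_{\mathsf T^\star}$ decides $\mathcal H=0$ if $L_{\mathsf T^\star}\le -A$, and decides $\mathcal H=1$ if $L_{\mathsf T^\star}\ge B$. The function $\psi$ and the thresholds $A,B$ can be evaluated numerically by solving the Bellman equation $$\widetilde{\mathcal V}(x)=\min\Big\{\phi(x),\ \min_{\delta\in\Pi}\Big[\mathcal C_\delta+\mathbb E\Big(\widetilde{\mathcal V}\Big(\frac{x e^{l_\delta}}{1-x+xe^{l_\delta}}\Big)\Big)\Big]\Big\},\qquad x\in[0,1].$$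
   Context: Model. There are $K$ sensors, $\Pi=\{1,\dots,K\}$, and a binary hypothesis $\mathcal H\in\{0,1\}$ with prior $\mathbb P(\mathcal H=i)=\pi_i$, $i=0,1$. Sensor $\ell$ produces samples with known density $f_i^\ell$ under $\mathcal H=i$; no two sensors have identical pairs $(f_0^\ell,f_1^\ell)$. Samples are i.i.d. over time for each sensor and independent across sensors, given $\mathcal H$. At each time $t$ exactly one sensor $\delta_t\in\Pi$ is selected as a function of $X_1,\dots,X_{t-1}$, and the sample $X_t$ is then drawn from $f_i^{\delta_t}$ under $\mathcal H=i$. A procedure $\{\boldsymbol\delta_{1:\mathsf T},D_{\mathsf T},\mathsf T\}$ consists of the selections $\boldsymbol\delta_{1:\mathsf T}=(\delta_1,\dots,\delta_{\mathsf T})$; a deterministic stopping rule $\mathsf T$ (whether $\mathsf T=t$ is determined by $X_1,\dots,X_t$); and a decision $D_{\mathsf T}\in\{0,1\}$ which on $\{\mathsf T=t\}$ is a function of $X_1,\dots,X_t$. $\mathbb E$ is expectation under the joint law of $\mathcal H$ and the samples. Costs. $\Omega\subseteq\Pi$ is the set of usage-constrained sensors; $\mathcal C_j=1+\lambda_j$ with $\lambda_j\ge 0$ for $j\in\Omega$, and $\mathcal C_j=1$ for $j\notin\Omega$. The constants $\mu_0,\mu_1\ge 0$ (Lagrange multipliers) weight the two types of error. Log-likelihood ratio: $l_\ell(X)=\log\frac{f_1^\ell(X)}{f_0^\ell(X)}$ and $L_n=\sum_{t=1}^n l_{\delta_t}(X_t)$, $L_0=0$. $\phi(x)=\min\{\mu_1x,\mu_0(1-x)\}$.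 $\widetilde{\mathcal V}(x)$ denotes the optimal cost of the infinite-horizon Bayes problem when the prior probability of $\mathcal H=1$ is $x$. In the Bellman equation $l_\delta=l_\delta(X)$, where $X$ is a sample from sensor $\delta$, and the expectation is over $X$ when $\mathcal H=1$ has probability $x$ and $\mathcal H=0$ has probability $1-x$. *)

theory Defs
  imports "HOL-Probability.Probability"
begin

section \<open>The sensor model\<close>

text \<open>
  The hypothesis \<open>H = 1\<close> is encoded by \<^term>\<open>True\<close> and \<open>H = 0\<close> by \<^term>\<open>False\<close>.
  The sensors are \<open>1, \<dots>, K\<close>. All densities are taken with respect to one \<open>\<sigma>\<close>-finite reference
  measure; Lebesgue measure and counting measure are the standard instances.
  The field \<open>extra_cost\<close> is \<open>\<lambda>\<close>, of which only the values on the constrained sensors matter.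
  The prior is not part of the model, because the value function varies it.
\<close>

record 'a sensor_model =
  num_sensors :: nat
  ref_measure :: "'a measure"
  dens :: "bool \<Rightarrow> nat \<Rightarrow> 'a \<Rightarrow> real"
  constrained :: "nat set"
  extra_cost :: "nat \<Rightarrow> real"
  mu0 :: real
  mu1 :: real

definition sensors :: "'a sensor_model \<Rightarrow> nat set" where
  "sensors M = {1..num_sensors M}"

definition valid_model :: "'a sensor_model \<Rightarrow> bool" where
  "valid_model M \<longleftrightarrow>
     num_sensors M \<ge> 1 \<and>
     sigma_finite_measure (ref_measure M) \<and>
     (\<forall>i. \<forall>l\<in>sensors M.
        dens M i l \<in> borel_measurable (ref_measure M) \<and>
        (\<forall>y\<in>space (ref_measure M). 0 \<le> dens M i l y) \<and>
        (\<integral>\<^sup>+ y. ennreal (dens M i l y) \<partial>ref_measure M) = 1) \<and>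
     (\<forall>l\<in>sensors M. \<forall>m\<in>sensors M. l \<noteq> m \<longrightarrow>
        (\<exists>i. \<exists>y\<in>space (ref_measure M). dens M i l y \<noteq> dens M i m y)) \<and>
     constrained M \<subseteq> sensors M \<and>
     (\<forall>j\<in>constrained M. 0 \<le> extra_cost M j) \<and>
     0 \<le> mu0 M \<and> 0 \<le> mu1 M"

definition usage_cost :: "'a sensor_model \<Rightarrow> nat \<Rightarrow> real" where
  "usage_cost M j = (if j \<in> constrained M then 1 + extra_cost M j else 1)"

text \<open>
  The sample space carries one sample \<open>\<omega> (t, l)\<close> for every time \<open>t \<ge> 1\<close> and sensor \<open>l\<close>; given the
  hypothesis, all of them are independent and \<open>\<omega> (t, l)\<close> has the density of sensor \<open>l\<close>.
  Only the sample of the selected sensor is observed.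
\<close>

definition sample_index :: "'a sensor_model \<Rightarrow> (nat \<times> nat) set" where
  "sample_index M = {1..} \<times> sensors M"

definition sample_law :: "'a sensor_model \<Rightarrow> bool \<Rightarrow> (nat \<times> nat \<Rightarrow> 'a) measure" where
  "sample_law M i =
     (\<Pi>\<^sub>M (t, l)\<in>sample_index M. density (ref_measure M) (\<lambda>y. ennreal (dens M i l y)))"

definition joint_law :: "'a sensor_model \<Rightarrow> real \<Rightarrow> (bool \<times> (nat \<times> nat \<Rightarrow> 'a)) measure" where
  "joint_law M x =
     measure_pmf (bernoulli_pmf x) \<bind>
       (\<lambda>i. distr (sample_law M i)
               (count_space UNIV \<Otimes>\<^sub>M (\<Pi>\<^sub>M tl\<in>sample_index M. ref_measure M))
               (\<lambda>\<omega>. (i, \<omega>)))"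


section \<open>Procedures and their cost\<close>

text \<open>
  A procedure acts on the list \<open>[X\<^sub>1, \<dots>, X\<^sub>t]\<close> of the observations made so far: \<open>select\<close> gives the next
  sensor \<open>\<delta>\<^sub>t\<^sub>+\<^sub>1\<close>, \<open>stop\<close> tells whether to stop at time \<open>t\<close> if this has not happened before, and \<open>decide\<close>
  gives the decision made upon stopping at time \<open>t\<close> (\<^term>\<open>True\<close> for \<open>H = 1\<close>).
\<close>

record 'a procedure =
  select :: "'a list \<Rightarrow> nat"
  stop :: "'a list \<Rightarrow> bool"
  decide :: "'a list \<Rightarrow> bool"

definition procedures :: "'a sensor_model \<Rightarrow> 'a procedure set" where
  "procedures M = {p. \<forall>n.
     (\<lambda>y. select p (map y [1..<Suc n]))
        \<in> (\<Pi>\<^sub>M t\<in>{1..n}. ref_measure M) \<rightarrow>\<^sub>M count_space (sensors M) \<and>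
     (\<lambda>y. stop p (map y [1..<Suc n]))
        \<in> (\<Pi>\<^sub>M t\<in>{1..n}. ref_measure M) \<rightarrow>\<^sub>M count_space UNIV \<and>
     (\<lambda>y. decide p (map y [1..<Suc n]))
        \<in> (\<Pi>\<^sub>M t\<in>{1..n}. ref_measure M) \<rightarrow>\<^sub>M count_space UNIV}"

primrec observations :: "'a procedure \<Rightarrow> (nat \<times> nat \<Rightarrow> 'a) \<Rightarrow> nat \<Rightarrow> 'a list" where
  "observations p \<omega> 0 = []"
| "observations p \<omega> (Suc t) =
     observations p \<omega> t @ [\<omega> (Suc t, select p (observations p \<omega> t))]"

text \<open>
  \<open>sensor_at p \<omega> t\<close> is \<open>\<delta>\<^sub>t\<close> and \<open>sample_at p \<omega> t\<close> is \<open>X\<^sub>t\<close>, both for \<open>t \<ge> 1\<close>.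
\<close>

definition sensor_at :: "'a procedure \<Rightarrow> (nat \<times> nat \<Rightarrow> 'a) \<Rightarrow> nat \<Rightarrow> nat" where
  "sensor_at p \<omega> t = select p (observations p \<omega> (t - 1))"

definition sample_at :: "'a procedure \<Rightarrow> (nat \<times> nat \<Rightarrow> 'a) \<Rightarrow> nat \<Rightarrow> 'a" where
  "sample_at p \<omega> t = \<omega> (t, sensor_at p \<omega> t)"

definition stopping_at :: "'a procedure \<Rightarrow> (nat \<times> nat \<Rightarrow> 'a) \<Rightarrow> enat" where
  "stopping_at p \<omega> = Inf {enat t |t. stop p (observations p \<omega> t)}"

text \<open>
  Every sample costs at least 1, so the total cost is infinite if the procedure never stops.
\<close>

definition realized_cost ::
  "'a sensor_model \<Rightarrow> 'a procedure \<Rightarrow> bool \<Rightarrow> (nat \<times> nat \<Rightarrow> 'a) \<Rightarrow> ennreal" where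
  "realized_cost M p i \<omega> =
     (case stopping_at p \<omega> of
        \<infinity> \<Rightarrow> \<infinity>
      | enat n \<Rightarrow>
          ennreal ((\<Sum>t=1..n. usage_cost M (sensor_at p \<omega> t)) +
            mu0 M * of_bool (decide p (observations p \<omega> n) \<and> \<not> i) +
            mu1 M * of_bool (\<not> decide p (observations p \<omega> n) \<and> i)))"

definition bayes_cost :: "'a sensor_model \<Rightarrow> real \<Rightarrow> 'a procedure \<Rightarrow> ennreal" where
  "bayes_cost M x p = (\<integral>\<^sup>+ (i, \<omega>). realized_cost M p i \<omega> \<partial>joint_law M x)"

definition optimal_procedure :: "'a sensor_model \<Rightarrow> real \<Rightarrow> 'a procedure \<Rightarrow> bool" where
  "optimal_procedure M x p \<longleftrightarrow> is_arg_min (bayes_cost M x) (\<lambda>q. q \<in> procedures M) p"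

definition bayes_value :: "'a sensor_model \<Rightarrow> real \<Rightarrow> ennreal" where
  "bayes_value M x = (INF p\<in>procedures M. bayes_cost M x p)"


section \<open>Log-likelihood ratios\<close>

text \<open>
  A density may vanish, hence the log-likelihood ratio is an extended real. Under either hypothesis,
  observations for which both densities vanish, and sums containing both infinities, have
  probability 0, so the values chosen for them are immaterial.
\<close>

definition llr :: "'a sensor_model \<Rightarrow> nat \<Rightarrow> 'a \<Rightarrow> ereal" where
  "llr M l y =
     (if dens M False l y > 0 \<and> dens M True l y > 0
        then ereal (ln (dens M True l y / dens M False l y))
      else if dens M True l y > 0 then \<infinity>
      else if dens M False l y > 0 then -\<infinity>
      else 0)"

definition cum_llr :: "'a sensor_model \<Rightarrow> 'a procedure \<Rightarrow> (nat \<times> nat \<Rightarrow> 'a) \<Rightarrow> nat \<Rightarrow> ereal" where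
  "cum_llr M p \<omega> n = (\<Sum>t=1..n. llr M (sensor_at p \<omega> t) (sample_at p \<omega> t))"

text \<open>
  \<open>posterior x l\<close> is \<open>x e\<^sup>l / (1 - x + x e\<^sup>l)\<close>, the probability of \<open>H = 1\<close> when its prior probability is \<open>x\<close>
  and the log-likelihood ratio of the data is \<open>l\<close>.
\<close>

fun posterior :: "real \<Rightarrow> ereal \<Rightarrow> real" where
  "posterior x (ereal r) = x * exp r / (1 - x + x * exp r)"
| "posterior x PInfty = 1"
| "posterior x MInfty = 0"


section \<open>The Bellman equation\<close>

definition stop_cost :: "'a sensor_model \<Rightarrow> real \<Rightarrow> real" where
  "stop_cost M x = min (mu1 M * x) (mu0 M * (1 - x))"

definition predictive_law :: "'a sensor_model \<Rightarrow> real \<Rightarrow> nat \<Rightarrow> 'a measure" where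
  "predictive_law M x l =
     density (ref_measure M) (\<lambda>y. ennreal ((1 - x) * dens M False l y + x * dens M True l y))"

definition continue_cost ::
  "'a sensor_model \<Rightarrow> (real \<Rightarrow> ennreal) \<Rightarrow> real \<Rightarrow> nat \<Rightarrow> ennreal" where
  "continue_cost M v x l =
     ennreal (usage_cost M l) + (\<integral>\<^sup>+ y. v (posterior x (llr M l y)) \<partial>predictive_law M x l)"

definition bellman_solution :: "'a sensor_model \<Rightarrow> (real \<Rightarrow> ennreal) \<Rightarrow> bool" where
  "bellman_solution M v \<longleftrightarrow>
     v \<in> borel_measurable (restrict_space borel {0..1}) \<and>
     (\<forall>x\<in>{0..1}. v x =
        min (ennreal (stop_cost M x)) (MIN l\<in>sensors M. continue_cost M v x l))"

text \<open>
  \<open>bellman_rule M x v \<psi> A B\<close>: for the prior probability \<open>x\<close> of \<open>H = 1\<close>, the selection function \<open>\<psi>\<close> and the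
  thresholds are read off from a solution \<open>v\<close> of the Bellman equation. The function \<open>\<psi>\<close> picks a
  minimising sensor, and \<open>(-A, B)\<close> is the set of log-likelihood ratios at which stopping is more
  expensive than \<open>v\<close>. If there are no such ratios, then the thresholds only have to make the test stop
  at time 0 with the cheaper decision.
\<close>

definition continuation_set :: "'a sensor_model \<Rightarrow> real \<Rightarrow> (real \<Rightarrow> ennreal) \<Rightarrow> real set" where
  "continuation_set M x v =
     {r. v (posterior x (ereal r)) < ennreal (stop_cost M (posterior x (ereal r)))}"

definition bellman_rule ::
  "'a sensor_model \<Rightarrow> real \<Rightarrow> (real \<Rightarrow> ennreal) \<Rightarrow> (ereal \<Rightarrow> nat) \<Rightarrow> real \<Rightarrow> real \<Rightarrow> bool" where
  "bellman_rule M x v \<psi> A B \<longleftrightarrow>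
     \<psi> \<in> borel \<rightarrow>\<^sub>M count_space (sensors M) \<and>
     (\<forall>r. is_arg_min (continue_cost M v (posterior x r)) (\<lambda>l. l \<in> sensors M) (\<psi> r)) \<and>
     - A < B \<and>
     (if continuation_set M x v \<noteq> {} then {- A<..<B} = continuation_set M x v
      else 0 \<le> - A \<and> mu1 M * x \<le> mu0 M * (1 - x) \<or>
           B \<le> 0 \<and> mu0 M * (1 - x) \<le> mu1 M * x)"


section \<open>Sequential probability ratio tests with stationary sensor selection\<close>

definition stationary_selection ::
  "'a sensor_model \<Rightarrow> 'a procedure \<Rightarrow> (ereal \<Rightarrow> nat) \<Rightarrow> bool" where
  "stationary_selection M p \<psi> \<longleftrightarrow>
     (\<forall>\<omega>. \<forall>t. sensor_at p \<omega> (Suc t) = \<psi> (cum_llr M p \<omega> t))"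

definition sprt_stopping :: "'a sensor_model \<Rightarrow> 'a procedure \<Rightarrow> real \<Rightarrow> real \<Rightarrow> bool" where
  "sprt_stopping M p A B \<longleftrightarrow>
     (\<forall>\<omega>. stopping_at p \<omega> =
        Inf {enat t |t. cum_llr M p \<omega> t \<notin> {ereal (- A)<..<ereal B}})"

definition sprt_decision :: "'a sensor_model \<Rightarrow> 'a procedure \<Rightarrow> real \<Rightarrow> real \<Rightarrow> bool" where
  "sprt_decision M p A B \<longleftrightarrow>
     (\<forall>\<omega>. \<forall>n. stopping_at p \<omega> = enat n \<longrightarrow>
        (cum_llr M p \<omega> n \<le> ereal (- A) \<longrightarrow> \<not> decide p (observations p \<omega> n)) \<and>
        (cum_llr M p \<omega> n \<ge> ereal B \<longrightarrow> decide p (observations p \<omega> n)))"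

end

theory Submission
  imports Defs
begin

text \<open>
  Bayes' rule turns an expectation under the joint law into one in which the hypothesis is replaced
  by its posterior probability, so the cost of any procedure is a series of expected stage costs in
  which the hypothesis no longer appears. For a solution \<open>v\<close> of the Bellman equation, the
  expected cost incurred before time \<open>n\<close> plus the expected value of \<open>v\<close> at the posterior of time \<open>n\<close>
  while the procedure is running is nondecreasing in \<open>n\<close>, and constant for the procedure that acts
  greedily with respect to \<open>v\<close>. Since every sample costs at least 1, the second term tends to 0 when
  the total cost is finite; hence \<open>v\<close> is the optimal cost, and the greedy procedure attains it. A
  solution exists as the limit of value iteration from 0.

  As an infimum of functions that are affine in the prior probability, the optimal cost is concave, and
  this makes its continuation set an interval. The interval is open by continuity, and bounded on the
  scale of the log-likelihood ratio because it pays to continue only if stopping costs more than 1.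
\<close>

text \<open>Concavity of the optimal cost does not by itself make the continuation set an interval:
  \<open>stop_cost\<close> is concave too, and a difference of concave functions has no sign
  pattern. The value is therefore compared with each of the two lines of \<open>stop_cost\<close>
  separately, along chords to the endpoints 0 and 1.

  Without a bound on the stopping time there is no last stage from which to argue backwards, so
  verification runs forward and has to control a remainder. A solution is at most
  \<open>mu1\<close>, and a stage at which the procedure goes on costs at least 1. So the expected
  value pending after stage n is at most \<open>mu1\<close> times the expected cost of stage n,
  which is a term of a convergent series. The estimate covers every solution, hence uniqueness.

  The observed sample is a coordinate with random index, because the sensor depends on the past.
  Splitting over the finitely many sensors fixes the index, and the fresh sample is then independent
  of the history.

  Densities may vanish, so Bayes' rule for one sample is used multiplied by the predictive density;
  where that density is zero, nothing is claimed about the updated posterior.\<close>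

section \<open>Histories and the law of the observations\<close>

text \<open>Independence of one sample from everything observed earlier, in the form that
  \<open>law_Suc\<close> needs: \<open>F w\<close> does not read coordinate \<open>j\<close>, so the
  actual sample may be replaced by an independent copy.\<close>

lemma nn_integral_PiM_coordinate:
  assumes M: "\<And>i. i \<in> I \<Longrightarrow> prob_space (M i)" and j: "j \<in> I"
    and F: "case_prod F \<in> borel_measurable (PiM I M \<Otimes>\<^sub>M M j)"
    and indep: "\<And>w y z. \<lbrakk>w \<in> space (PiM I M); y \<in> space (M j); z \<in> space (M j)\<rbrakk> \<Longrightarrow> F (w(j := z)) y = F w y"
  shows "(\<integral>\<^sup>+ w. F w (w j) \<partial>PiM I M) = (\<integral>\<^sup>+ w. \<integral>\<^sup>+ y. F w y \<partial>M j \<partial>PiM I M)"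
proof -
  define J where "J = I - {j}"
  have I: "I = insert j J"
    using j by (auto simp: J_def)
  interpret Mj: prob_space "M j"
    using M j by blast
  interpret PJ: prob_space "PiM J M"
    using M by (intro prob_space_PiM) (auto simp: J_def)
  note F' [measurable] = F [unfolded I]
  have meas_upd [measurable]: "(\<lambda>(x, X). X(j := x)) \<in> M j \<Otimes>\<^sub>M PiM J M \<rightarrow>\<^sub>M PiM (insert j J) M"
    by measurable
  have upd: "X(j := x) \<in> space (PiM I M)" if "x \<in> space (M j)" "X \<in> space (PiM J M)" for x X
    using measurable_space [OF meas_upd, of "(x, X)"] that by (simp add: space_pair_measure I)
  have eq: "PiM I M = distr (M j \<Otimes>\<^sub>M PiM J M) (PiM (insert j J) M) (\<lambda>(x, X). X(j := x))"
    using M j by (subst distr_pair_PiM_eq_PiM) (auto simp: I)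
  have proj: "(\<lambda>w. w j) \<in> PiM (insert j J) M \<rightarrow>\<^sub>M M j"
    by measurable
  have meas1: "(\<lambda>w. F w (w j)) \<in> borel_measurable (PiM (insert j J) M)"
    using measurable_compose [OF measurable_Pair [OF measurable_ident proj] F'] by simp
  have meas2: "(\<lambda>w. \<integral>\<^sup>+ y. F w y \<partial>M j) \<in> borel_measurable (PiM (insert j J) M)"
    by measurable
  have "(\<integral>\<^sup>+ w. F w (w j) \<partial>PiM I M) = (\<integral>\<^sup>+ (x, X). F (X(j := x)) x \<partial>(M j \<Otimes>\<^sub>M PiM J M))"
    unfolding eq by (subst nn_integral_distr [OF meas_upd]) (use meas1 in \<open>auto intro!: nn_integral_cong\<close>)
  also have "\<dots> = (\<integral>\<^sup>+ x. \<integral>\<^sup>+ X. F (X(j := x)) x \<partial>PiM J M \<partial>M j)"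
    using measurable_compose [OF meas_upd meas1]
    by (subst PJ.nn_integral_fst [symmetric]) (simp_all add: split_beta')
  \<comment> \<open>A fresh variable takes over the role of the sample. After the exchange the outer
    variable no longer occurs in the integrand, and its measure has total mass 1.\<close>
  also have "\<dots> = (\<integral>\<^sup>+ x. \<integral>\<^sup>+ z. \<integral>\<^sup>+ X. F (X(j := x)) z \<partial>PiM J M \<partial>M j \<partial>M j)"
  proof -
    have 1: "(\<integral>\<^sup>+ x. \<integral>\<^sup>+ z. \<integral>\<^sup>+ X. F (X(j := x)) z \<partial>PiM J M \<partial>M j \<partial>M j)
       = (\<integral>\<^sup>+ x. \<integral>\<^sup>+ z. \<integral>\<^sup>+ X. F (X(j := z)) z \<partial>PiM J M \<partial>M j \<partial>M j)"
    proof (intro nn_integral_cong)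
      fix x z X assume a: "x \<in> space (M j)" "z \<in> space (M j)" "X \<in> space (PiM J M)"
      show "F (X(j := x)) z = F (X(j := z)) z"
        using indep [OF upd [OF a(1) a(3)] a(2) a(2)] by simp
    qed
    show ?thesis
      unfolding 1 by (simp add: Mj.emeasure_space_1)
  qed
  also have "\<dots> = (\<integral>\<^sup>+ x. \<integral>\<^sup>+ X. \<integral>\<^sup>+ z. F (X(j := x)) z \<partial>M j \<partial>PiM J M \<partial>M j)"
  proof (intro nn_integral_cong)
    fix x assume x: "x \<in> space (M j)"
    interpret pair_sigma_finite "M j" "PiM J M" ..
    have c: "(\<lambda>(z, X). (X(j := x), z)) \<in> M j \<Otimes>\<^sub>M PiM J M \<rightarrow>\<^sub>M PiM (insert j J) M \<Otimes>\<^sub>M M j"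
      using x by (intro measurable_pair) (auto simp: comp_def split_beta')
    have "(\<lambda>(z, X). F (X(j := x)) z) \<in> borel_measurable (M j \<Otimes>\<^sub>M PiM J M)"
      using measurable_compose [OF c F'] by (simp add: split_beta')
    from Fubini' [OF this]
    show "(\<integral>\<^sup>+ z. \<integral>\<^sup>+ X. F (X(j := x)) z \<partial>PiM J M \<partial>M j) = (\<integral>\<^sup>+ X. \<integral>\<^sup>+ z. F (X(j := x)) z \<partial>M j \<partial>PiM J M)"
      by simp
  qed
  also have "\<dots> = (\<integral>\<^sup>+ (x, X). \<integral>\<^sup>+ z. F (X(j := x)) z \<partial>M j \<partial>(M j \<Otimes>\<^sub>M PiM J M))"
    using measurable_compose [OF meas_upd meas2]
    by (subst PJ.nn_integral_fst [symmetric]) (simp_all add: split_beta')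
  also have "\<dots> = (\<integral>\<^sup>+ w. \<integral>\<^sup>+ y. F w y \<partial>M j \<partial>PiM I M)"
    unfolding eq by (subst nn_integral_distr [OF meas_upd]) (use meas2 in \<open>auto intro!: nn_integral_cong\<close>)
  finally show ?thesis .
qed

text \<open>Serves the case of a procedure that never stops: its series of stage costs must give the
  infinite value that \<open>realized_cost\<close> assigns.\<close>

lemma suminf_eq_top_if_ge_1:
  fixes f :: "nat \<Rightarrow> ennreal"
  assumes "\<And>k. 1 \<le> f k"
  shows "suminf f = \<top>"
proof (rule ccontr)
  assume "suminf f \<noteq> \<top>"
  then obtain r where r: "suminf f = ennreal r" "0 \<le> r"
    by (cases "suminf f") auto
  obtain n :: nat where n: "r < real n"
    using reals_Archimedean2 by blast
  have "ennreal (real n) = (\<Sum>k<n. 1)"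
    by (simp add: ennreal_of_nat_eq_real_of_nat)
  also have "\<dots> \<le> (\<Sum>k<n. f k)"
    by (intro sum_mono assms)
  also have "\<dots> \<le> suminf f"
    by (intro sum_le_suminf) auto
  finally show False
    using n r by (simp add: ennreal_le_iff)
qed

lemma map_fun_upd_upt: "map (h(Suc n := y)) [1..<Suc (Suc n)] = map h [1..<Suc n] @ [y]"
  by (simp cong: map_cong)

lemma observations_eq_map: "observations p \<omega> n = map (sample_at p \<omega>) [1..<Suc n]"
  by (induction n) (auto simp: sample_at_def sensor_at_def simp del: upt_Suc simp: upt_Suc_append)

lemma length_observations [simp]: "length (observations p \<omega> n) = n"
  by (simp add: observations_eq_map del: upt_Suc)

lemma take_observations: "k \<le> n \<Longrightarrow> take k (observations p \<omega> n) = observations p \<omega> k"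
  by (simp add: observations_eq_map take_map take_upt del: upt_Suc)

lemma observations_cong:
  "(\<And>t l. t \<le> n \<Longrightarrow> \<omega> (t, l) = \<omega>' (t, l)) \<Longrightarrow> observations p \<omega> n = observations p \<omega>' n"
  by (induction n) auto

locale sensor_testing =
  fixes M :: "'a sensor_model"
  assumes valid: "valid_model M"
begin

abbreviation "R \<equiv> ref_measure M"
abbreviation "Samp \<equiv> \<Pi>\<^sub>M tl\<in>sample_index M. R"
abbreviation "Hist n \<equiv> \<Pi>\<^sub>M t\<in>{1..n}. R"

text \<open>Lists carry no sigma-algebra here, so measurability of a function of the history is
  tested on its coordinates, as in \<open>procedures\<close>.\<close>

definition hist_measurable :: "nat \<Rightarrow> 'b measure \<Rightarrow> ('a list \<Rightarrow> 'b) \<Rightarrow> bool" where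
  "hist_measurable n N g \<longleftrightarrow> (\<lambda>h. g (map h [1..<Suc n])) \<in> Hist n \<rightarrow>\<^sub>M N"

sublocale ref: sigma_finite_measure R
  using valid by (simp add: valid_model_def)

lemma dens_measurable [measurable]: "l \<in> sensors M \<Longrightarrow> dens M i l \<in> borel_measurable R"
  using valid by (simp add: valid_model_def)

lemma dens_nonneg: "l \<in> sensors M \<Longrightarrow> y \<in> space R \<Longrightarrow> 0 \<le> dens M i l y"
  using valid by (simp add: valid_model_def)

lemma nn_integral_dens: "l \<in> sensors M \<Longrightarrow> (\<integral>\<^sup>+ y. ennreal (dens M i l y) \<partial>R) = 1"
  using valid by (simp add: valid_model_def)

lemma finite_sensors [simp]: "finite (sensors M)"
  by (simp add: sensors_def)

lemma sensors_nonempty [simp]: "sensors M \<noteq> {}"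
  using valid by (simp add: sensors_def valid_model_def)

lemma mu_nonneg: "0 \<le> mu0 M" "0 \<le> mu1 M"
  using valid by (auto simp: valid_model_def)

lemma one_le_usage_cost: "1 \<le> usage_cost M l"
  using valid by (auto simp: usage_cost_def valid_model_def)

lemma hist_measurable_snoc:
  assumes "hist_measurable (Suc n) N g"
  shows "(\<lambda>(h, y). g (map h [1..<Suc n] @ [y])) \<in> Hist n \<Otimes>\<^sub>M R \<rightarrow>\<^sub>M N"
proof -
  have "(\<lambda>(h, y). h(Suc n := y)) \<in> Hist n \<Otimes>\<^sub>M R \<rightarrow>\<^sub>M (\<Pi>\<^sub>M t\<in>insert (Suc n) {1..n}. R)"
    by (rule measurable_add_dim)
  also have "insert (Suc n) {1..n} = {1..Suc n}"
    by auto
  finally have "(\<lambda>(h, y). h(Suc n := y)) \<in> Hist n \<Otimes>\<^sub>M R \<rightarrow>\<^sub>M Hist (Suc n)" .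
  from measurable_compose [OF this assms [unfolded hist_measurable_def]]
  show ?thesis
    by (simp add: split_beta' map_fun_upd_upt [unfolded One_nat_def] del: upt_Suc)
qed

lemma hist_measurable_take:
  assumes "hist_measurable k N g" "k \<le> n"
  shows "hist_measurable n N (\<lambda>ys. g (take k ys))"
proof -
  have "(\<lambda>h. restrict h {1..k}) \<in> Hist n \<rightarrow>\<^sub>M Hist k"
    using assms(2) by (intro measurable_restrict_subset) auto
  from measurable_compose [OF this assms(1) [unfolded hist_measurable_def]]
  have "(\<lambda>h. g (map (restrict h {1..k}) [1..<Suc k])) \<in> Hist n \<rightarrow>\<^sub>M N" .
  moreover have "map (restrict h {1..k}) [1..<Suc k] = take k (map h [1..<Suc n])" for h :: "nat \<Rightarrow> 'a"
    using assms(2) by (auto simp: take_map take_upt simp del: upt_Suc)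
  ultimately show ?thesis
    by (simp add: hist_measurable_def del: upt_Suc)
qed

lemma sets_sample_law: "sets (sample_law M i) = sets Samp"
  unfolding sample_law_def by (intro sets_PiM_cong) (auto simp: split_beta')

lemma prob_space_density: "l \<in> sensors M \<Longrightarrow> prob_space (density R (\<lambda>y. ennreal (dens M i l y)))"
  by (intro prob_spaceI) (simp add: emeasure_density nn_integral_dens cong: nn_integral_cong)

lemma prob_space_sample_law: "prob_space (sample_law M i)"
  unfolding sample_law_def
  by (intro prob_space_PiM) (auto simp: sample_index_def intro: prob_space_density)

lemma measurable_sample_law: "(f \<in> sample_law M i \<rightarrow>\<^sub>M N) = (f \<in> Samp \<rightarrow>\<^sub>M N)"
  by (rule arg_cong [where f = "\<lambda>A. f \<in> A"], intro measurable_cong_sets sets_sample_law refl)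

end

section \<open>Observations of one procedure and their law under a hypothesis\<close>

locale procedure_testing = sensor_testing +
  fixes p :: "'a procedure"
  assumes procedure: "p \<in> procedures M"
begin

lemma
  shows hist_measurable_select: "hist_measurable n (count_space (sensors M)) (select p)"
    and hist_measurable_stop: "hist_measurable n (count_space UNIV) (stop p)"
    and hist_measurable_decide: "hist_measurable n (count_space UNIV) (decide p)"
  using procedure by (auto simp: procedures_def hist_measurable_def)

text \<open>The observations as a point of a product space, which carries the measurability that
  lists cannot.\<close>

definition obs_vector :: "nat \<Rightarrow> (nat \<times> nat \<Rightarrow> 'a) \<Rightarrow> nat \<Rightarrow> 'a" where
  "obs_vector n \<omega> = (\<lambda>t\<in>{1..n}. sample_at p \<omega> t)"

lemma observations_eq_obs_vector: "observations p \<omega> n = map (obs_vector n \<omega>) [1..<Suc n]"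
  unfolding observations_eq_map by (intro map_cong) (auto simp: obs_vector_def)

lemma measurable_obs_vector: "obs_vector n \<in> Samp \<rightarrow>\<^sub>M Hist n"
proof (induction n)
  case 0
  show ?case
    by (rule measurable_PiM_single') (auto simp: obs_vector_def)
next
  case (Suc n)
  note [measurable] = Suc
  have sel: "(\<lambda>w. select p (observations p w n)) \<in> Samp \<rightarrow>\<^sub>M count_space (sensors M)"
    unfolding observations_eq_obs_vector
    by (rule measurable_compose [OF Suc hist_measurable_select [unfolded hist_measurable_def]])
  have samp: "(\<lambda>w. w (Suc n, select p (observations p w n))) \<in> Samp \<rightarrow>\<^sub>M R"
    by (rule measurable_compose_countable' [OF _ sel])
      (auto intro!: measurable_component_singleton countable_finite simp: sample_index_def)
  have eq: "obs_vector (Suc n) w = (obs_vector n w)(Suc n := w (Suc n, select p (observations p w n)))" for w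
    by (rule ext) (auto simp: obs_vector_def sample_at_def sensor_at_def)
  have "(\<lambda>w. (obs_vector n w, w (Suc n, select p (observations p w n)))) \<in> Samp \<rightarrow>\<^sub>M Hist n \<Otimes>\<^sub>M R"
    using samp by measurable
  from measurable_compose [OF this measurable_add_dim [of "Suc n" _ "\<lambda>_. R"]]
  have "obs_vector (Suc n) \<in> Samp \<rightarrow>\<^sub>M (\<Pi>\<^sub>M t\<in>insert (Suc n) {1..n}. R)"
    by (simp add: eq [abs_def] cong: measurable_cong)
  also have "insert (Suc n) {1..n} = {1..Suc n}"
    by auto
  finally show ?case .
qed

lemma measurable_observations:
  "hist_measurable n N g \<Longrightarrow> (\<lambda>\<omega>. g (observations p \<omega> n)) \<in> Samp \<rightarrow>\<^sub>M N"
  unfolding observations_eq_obs_vector hist_measurable_def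
  by (rule measurable_compose [OF measurable_obs_vector])

lemma select_in_sensors: "\<omega> \<in> space Samp \<Longrightarrow> select p (observations p \<omega> n) \<in> sensors M"
  using measurable_space [OF measurable_observations [OF hist_measurable_select]] by simp

lemma select_hist_in_sensors: "h \<in> space (Hist n) \<Longrightarrow> select p (map h [1..<Suc n]) \<in> sensors M"
  using measurable_space [OF hist_measurable_select [unfolded hist_measurable_def]] by simp

definition law :: "bool \<Rightarrow> nat \<Rightarrow> ('a list \<Rightarrow> ennreal) \<Rightarrow> ennreal" where
  "law i n g = (\<integral>\<^sup>+ \<omega>. g (observations p \<omega> n) \<partial>sample_law M i)"

text \<open>The one-step transition operator of the observation process under a fixed
  hypothesis.\<close>

definition step :: "bool \<Rightarrow> ('a list \<Rightarrow> ennreal) \<Rightarrow> 'a list \<Rightarrow> ennreal" where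
  "step i g ys = (\<integral>\<^sup>+ y. ennreal (dens M i (select p ys) y) * g (ys @ [y]) \<partial>R)"

lemma measurable_dens_select [measurable]:
  "(\<lambda>(h, y). dens M i (select p (map h [1..<Suc n])) y) \<in> borel_measurable (Hist n \<Otimes>\<^sub>M R)"
proof -
  have sel: "(\<lambda>z. select p (map (fst z) [1..<Suc n])) \<in> Hist n \<Otimes>\<^sub>M R \<rightarrow>\<^sub>M count_space (sensors M)"
    by (rule measurable_compose [OF measurable_fst hist_measurable_select [unfolded hist_measurable_def]])
  show ?thesis
    unfolding split_beta'
    by (rule measurable_compose_countable' [OF _ sel]) (auto intro!: countable_finite)
qed

lemma hist_measurable_step:
  assumes "hist_measurable (Suc n) borel g"
  shows "hist_measurable n borel (step i g)"
  using hist_measurable_snoc [OF assms] measurable_dens_select [of i n]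
  unfolding hist_measurable_def step_def by measurable

text \<open>The history of length \<open>n\<close> reads only samples with times up to
  \<open>n\<close> (\<open>observations_cong\<close>), so a sample of time \<open>Suc n\<close> is
  independent of it. The selected sensor is random; indicators of the finitely many sensors leave a
  fixed coordinate, to which \<open>nn_integral_PiM_coordinate\<close> applies.\<close>

lemma law_Suc:
  assumes g: "hist_measurable (Suc n) borel g"
  shows "law i (Suc n) g = law i n (step i g)"
proof -
  define D where "D = (\<lambda>l. density R (\<lambda>y. ennreal (dens M i l y)))"
  define F where "F = (\<lambda>l w y. g (observations p w n @ [y]) * indicator {l} (select p (observations p w n)))"
  have sl: "sample_law M i = PiM (sample_index M) (\<lambda>tl. D (snd tl))"
    by (simp add: sample_law_def D_def split_beta')
  have sel: "(\<lambda>w. select p (observations p w n)) \<in> Samp \<rightarrow>\<^sub>M count_space (sensors M)"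
    by (rule measurable_observations [OF hist_measurable_select])
  have pair: "(\<lambda>(w, y). (obs_vector n w, y)) \<in> Samp \<Otimes>\<^sub>M R \<rightarrow>\<^sub>M Hist n \<Otimes>\<^sub>M R"
    using measurable_obs_vector by measurable
  have G: "(\<lambda>(w, y). g (observations p w n @ [y])) \<in> borel_measurable (Samp \<Otimes>\<^sub>M R)"
    using measurable_compose [OF pair hist_measurable_snoc [OF g]]
    by (simp add: observations_eq_obs_vector split_beta' del: upt_Suc)
  have F [measurable]: "case_prod (F l) \<in> borel_measurable (Samp \<Otimes>\<^sub>M R)" if "l \<in> sensors M" for l
  proof -
    have "(\<lambda>z. indicator {l} (select p (observations p (fst z) n)) :: ennreal) \<in> borel_measurable (Samp \<Otimes>\<^sub>M R)"
      by (rule measurable_compose [OF measurable_compose [OF measurable_fst sel]]) simp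
    from borel_measurable_times_ennreal [OF G [unfolded split_beta'] this] show ?thesis
      by (simp add: F_def split_beta')
  qed
  have comp: "(\<lambda>w. F l w (w (Suc n, l))) \<in> borel_measurable (sample_law M i)" if l: "l \<in> sensors M" for l
  proof -
    have "(Suc n, l) \<in> sample_index M"
      using l by (simp add: sample_index_def)
    then have "(\<lambda>w. (w, w (Suc n, l))) \<in> Samp \<rightarrow>\<^sub>M Samp \<Otimes>\<^sub>M R"
      by measurable
    from measurable_compose [OF this F [OF l]] show ?thesis
      by (simp add: measurable_sample_law)
  qed
  have sp: "space (sample_law M i) = space Samp"
    by (rule sets_eq_imp_space_eq [OF sets_sample_law])
  have "law i (Suc n) g = (\<integral>\<^sup>+ w. (\<Sum>l\<in>sensors M. F l w (w (Suc n, l))) \<partial>sample_law M i)"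
    unfolding law_def
  proof (intro nn_integral_cong)
    fix w assume "w \<in> space (sample_law M i)"
    then have "select p (observations p w n) \<in> sensors M"
      using sp by (auto intro: select_in_sensors)
    then show "g (observations p w (Suc n)) = (\<Sum>l\<in>sensors M. F l w (w (Suc n, l)))"
      by (subst sum.remove [of _ "select p (observations p w n)"]) (auto simp: F_def)
  qed
  also have "\<dots> = (\<Sum>l\<in>sensors M. \<integral>\<^sup>+ w. F l w (w (Suc n, l)) \<partial>sample_law M i)"
    by (rule nn_integral_sum) (rule comp)
  also have "\<dots> = (\<Sum>l\<in>sensors M. \<integral>\<^sup>+ w. \<integral>\<^sup>+ y. F l w y \<partial>D l \<partial>sample_law M i)"
  proof (intro sum.cong refl)
    fix l assume l: "l \<in> sensors M"
    have sets: "sets (sample_law M i \<Otimes>\<^sub>M D l) = sets (Samp \<Otimes>\<^sub>M R)"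
      by (intro sets_pair_measure_cong sets_sample_law) (simp add: D_def)
    have Fl: "case_prod (F l) \<in> borel_measurable (sample_law M i \<Otimes>\<^sub>M D l)"
      using F [OF l] measurable_cong_sets [OF sets refl] by blast
    show "(\<integral>\<^sup>+ w. F l w (w (Suc n, l)) \<partial>sample_law M i) = (\<integral>\<^sup>+ w. \<integral>\<^sup>+ y. F l w y \<partial>D l \<partial>sample_law M i)"
      unfolding sl
    proof (subst nn_integral_PiM_coordinate)
      fix w :: "nat \<times> nat \<Rightarrow> 'a" and y z
      have "observations p (w((Suc n, l) := z)) n = observations p w n"
        by (rule observations_cong) auto
      then show "F l (w((Suc n, l) := z)) y = F l w y"
        by (simp add: F_def)
    next
      show "case_prod (F l) \<in> borel_measurable (PiM (sample_index M) (\<lambda>tl. D (snd tl)) \<Otimes>\<^sub>M D (snd (Suc n, l)))"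
        using Fl by (simp add: sl)
    qed (use l in \<open>auto simp: sample_index_def D_def intro: prob_space_density\<close>)
  qed
  also have "\<dots> = (\<integral>\<^sup>+ w. (\<Sum>l\<in>sensors M. \<integral>\<^sup>+ y. F l w y \<partial>D l) \<partial>sample_law M i)"
  proof (rule nn_integral_sum [symmetric])
    fix l assume l: "l \<in> sensors M"
    have "case_prod (F l) \<in> borel_measurable (sample_law M i \<Otimes>\<^sub>M R)"
      using F [OF l] measurable_cong_sets [OF sets_pair_measure_cong [OF sets_sample_law refl] refl] by blast
    then show "(\<lambda>w. \<integral>\<^sup>+ y. F l w y \<partial>D l) \<in> borel_measurable (sample_law M i)"
      using l prob_space_imp_sigma_finite [OF prob_space_density [OF l, of i]]
      by (intro sigma_finite_measure.borel_measurable_nn_integral) (auto simp: D_def cong: measurable_cong_sets)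
  qed
  also have "\<dots> = law i n (step i g)"
    unfolding law_def
  proof (intro nn_integral_cong)
    fix w assume "w \<in> space (sample_law M i)"
    then have w: "w \<in> space Samp"
      using sp by simp
    define s where "s = select p (observations p w n)"
    have s: "s \<in> sensors M"
      using w select_in_sensors by (simp add: s_def)
    have "(\<Sum>l\<in>sensors M. \<integral>\<^sup>+ y. F l w y \<partial>D l) = (\<integral>\<^sup>+ y. F s w y \<partial>D s)"
      using s by (subst sum.remove [of _ s]) (auto simp: F_def s_def)
    also have "\<dots> = (\<integral>\<^sup>+ y. ennreal (dens M i s y) * F s w y \<partial>R)"
      unfolding D_def using s w measurable_compose_Pair1 [OF w F [OF s]]
      by (intro nn_integral_density) auto
    also have "\<dots> = step i g (observations p w n)"
      by (simp add: step_def F_def s_def)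
    finally show "(\<Sum>l\<in>sensors M. \<integral>\<^sup>+ y. F l w y \<partial>D l) = step i g (observations p w n)" .
  qed
  finally show ?thesis .
qed

lemma law_0: "law i 0 g = g []"
  using prob_space.emeasure_space_1 [OF prob_space_sample_law] by (simp add: law_def)

end

section \<open>Bayes' rule along histories\<close>

lemma posterior_infinity [simp]: "posterior x \<infinity> = 1" "posterior x (-\<infinity>) = 0"
  using posterior.simps(2,3) by (simp_all del: posterior.simps)

lemma posterior_cases:
  "posterior x l = (if l = \<infinity> then 1 else if l = -\<infinity> then 0
     else x * exp (real_of_ereal l) / (1 - x + x * exp (real_of_ereal l)))"
  by (cases l) auto

lemma measurable_posterior [measurable (raw)]:
  assumes [measurable]: "f \<in> borel_measurable N" "g \<in> borel_measurable N"
  shows "(\<lambda>z. posterior (f z) (g z)) \<in> borel_measurable N"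
  unfolding posterior_cases by measurable

lemma posterior_denominator_pos:
  fixes x :: real
  assumes "0 \<le> x" "x \<le> 1" "0 < r"
  shows "0 < 1 - x + x * r"
  using assms by (cases "x = 0") (auto intro: add_nonneg_pos)

lemma posterior_bounds:
  assumes "0 \<le> x" "x \<le> 1"
  shows "0 \<le> posterior x l" "posterior x l \<le> 1"
  using assms posterior_denominator_pos [OF assms, of "exp (real_of_ereal l)"]
  by (auto simp: posterior_cases divide_simps)

lemma posterior_zero_right [simp]: "posterior x 0 = x"
  by (simp add: zero_ereal_def)

text \<open>Each update multiplies the odds, so log-likelihood ratios add. This is why their sum can
  serve as the state of the procedure.\<close>

lemma posterior_posterior:
  assumes "0 \<le> x" "x \<le> 1"
  shows "posterior (posterior x (ereal r)) (ereal s) = posterior x (ereal (r + s))"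
proof -
  have pos: "0 < 1 - x + x * exp r" "0 < 1 - x + x * exp (r + s)"
    using assms by (auto intro: posterior_denominator_pos)
  define d where "d = 1 - x + x * exp r"
  have d: "0 < d"
    using pos by (simp add: d_def)
  have "1 - x * exp r / d + x * exp r / d * exp s = (d - x * exp r + x * exp r * exp s) / d"
    using d by (simp add: add_divide_distrib diff_divide_distrib)
  also have "d - x * exp r + x * exp r * exp s = 1 - x + x * exp (r + s)"
    by (simp add: d_def exp_add)
  finally have "posterior (posterior x (ereal r)) (ereal s) = (x * exp r / d * exp s) / ((1 - x + x * exp (r + s)) / d)"
    by (simp add: d_def)
  also have "\<dots> = posterior x (ereal (r + s))"
    using pos d by (simp add: exp_add)
  finally show ?thesis .
qed

context sensor_testing
begin

definition pred_dens :: "real \<Rightarrow> nat \<Rightarrow> 'a \<Rightarrow> real" where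
  "pred_dens x l y = (1 - x) * dens M False l y + x * dens M True l y"

lemma pred_dens_nonneg:
  "\<lbrakk>l \<in> sensors M; y \<in> space R; 0 \<le> x; x \<le> 1\<rbrakk> \<Longrightarrow> 0 \<le> pred_dens x l y"
  by (simp add: pred_dens_def dens_nonneg)

lemma measurable_llr [measurable]: "l \<in> sensors M \<Longrightarrow> llr M l \<in> borel_measurable R"
  unfolding llr_def [abs_def] by measurable

text \<open>Bayes' rule for one sample, cleared of its denominator so that it also holds where the
  predictive density vanishes.\<close>

lemma posterior_llr_times_pred_dens:
  assumes l: "l \<in> sensors M" and y: "y \<in> space R" and x: "0 \<le> x" "x \<le> 1"
  shows "posterior x (llr M l y) * pred_dens x l y = x * dens M True l y"
    and "(1 - posterior x (llr M l y)) * pred_dens x l y = (1 - x) * dens M False l y"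
proof -
  define f0 f1 where "f0 = dens M False l y" and "f1 = dens M True l y"
  have nn: "0 \<le> f0" "0 \<le> f1"
    using dens_nonneg [OF l y] by (auto simp: f0_def f1_def)
  have llr: "llr M l y = (if f0 > 0 \<and> f1 > 0 then ereal (ln (f1 / f0)) else if f1 > 0 then \<infinity> else if f0 > 0 then -\<infinity> else 0)"
    by (simp add: llr_def f0_def f1_def)
  have pd: "pred_dens x l y = (1 - x) * f0 + x * f1"
    by (simp add: pred_dens_def f0_def f1_def)
  have *: "posterior x (llr M l y) * pred_dens x l y = x * f1"
  proof (cases "f0 > 0 \<and> f1 > 0")
    case True
    then have "0 < 1 - x + x * (f1 / f0)"
      by (intro posterior_denominator_pos x) simp
    moreover have "(1 - x) * f0 + x * f1 = (1 - x + x * (f1 / f0)) * f0"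
      using True by (simp add: field_simps)
    ultimately show ?thesis
      using True unfolding pd llr by simp
  next
    case False
    then show ?thesis
      using nn unfolding pd llr by (auto simp: less_le)
  qed
  then show "posterior x (llr M l y) * pred_dens x l y = x * dens M True l y"
    by (simp add: f1_def)
  show "(1 - posterior x (llr M l y)) * pred_dens x l y = (1 - x) * dens M False l y"
    using * by (simp add: pd left_diff_distrib f0_def)
qed

text \<open>
  The exceptional case \<open>pred_dens = 0\<close> covers sums of opposite infinities, whose value is \<open>\<infinity>\<close>.
\<close>

lemma posterior_add_llr:
  assumes l: "l \<in> sensors M" and y: "y \<in> space R" and x: "0 \<le> x" "x \<le> 1"
    and nz: "pred_dens (posterior x L) l y \<noteq> 0"
  shows "posterior x (L + llr M l y) = posterior (posterior x L) (llr M l y)"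
proof (cases L)
  case (real r)
  show ?thesis
  proof (cases "llr M l y")
    case (real s)
    then show ?thesis
      using \<open>L = ereal r\<close> posterior_posterior [OF x, of r s] by simp
  qed (use \<open>L = ereal r\<close> in auto)
next
  case PInf
  \<comment> \<open>At posterior 1 the predictive density is the density under \<open>True\<close>,
    which vanishes wherever the ratio is minus infinity.\<close>
  have "llr M l y \<noteq> -\<infinity>"
  proof
    assume "llr M l y = -\<infinity>"
    then have "dens M True l y = 0"
      using dens_nonneg [OF l y, of True] by (auto simp: llr_def split: if_splits)
    then show False
      using nz PInf by (simp add: pred_dens_def)
  qed
  then show ?thesis
    using PInf by (cases "llr M l y") auto
next
  case MInf
  have "llr M l y \<noteq> \<infinity>"
  proof
    assume "llr M l y = \<infinity>"
    then have "dens M False l y = 0"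
      using dens_nonneg [OF l y, of False] by (auto simp: llr_def split: if_splits)
    then show False
      using nz MInf by (simp add: pred_dens_def)
  qed
  then show ?thesis
    using MInf by (cases "llr M l y") auto
qed

lemma nn_integral_pred_dens:
  assumes l: "l \<in> sensors M" and x: "0 \<le> x" "x \<le> 1"
  shows "(\<integral>\<^sup>+ y. ennreal (pred_dens x l y) \<partial>R) = 1"
proof -
  have "(\<integral>\<^sup>+ y. ennreal (pred_dens x l y) \<partial>R)
      = (\<integral>\<^sup>+ y. ennreal (1 - x) * ennreal (dens M False l y) + ennreal x * ennreal (dens M True l y) \<partial>R)"
    using x by (intro nn_integral_cong)
      (simp add: pred_dens_def dens_nonneg l ennreal_mult' [symmetric] flip: ennreal_plus)
  also have "\<dots> = ennreal (1 - x) + ennreal x"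
    using l by (simp add: nn_integral_add nn_integral_cmult nn_integral_dens)
  also have "\<dots> = 1"
    using x by (simp flip: ennreal_plus)
  finally show ?thesis .
qed

lemma continue_cost_eq:
  assumes l: "l \<in> sensors M" and v: "v \<in> borel_measurable borel"
  shows "continue_cost M v x l =
    ennreal (usage_cost M l) + (\<integral>\<^sup>+ y. ennreal (pred_dens x l y) * v (posterior x (llr M l y)) \<partial>R)"
  using l v unfolding continue_cost_def predictive_law_def pred_dens_def
  by (subst nn_integral_density) auto

text \<open>Posteriors stay in [0, 1], so values elsewhere do not enter. This allows a solution to
  be replaced by its extension by zero.\<close>

lemma continue_cost_cong:
  assumes x: "0 \<le> x" "x \<le> 1" and vw: "\<And>q. 0 \<le> q \<Longrightarrow> q \<le> 1 \<Longrightarrow> v q = w q"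
  shows "continue_cost M v x l = continue_cost M w x l"
  unfolding continue_cost_def using posterior_bounds [OF x] vw by simp

end

context procedure_testing
begin

text \<open>Procedures are constrained only on samples from the space of the reference measure, so
  pointwise claims about \<open>select\<close> are made for these lists.\<close>

definition histories :: "nat \<Rightarrow> 'a list set" where
  "histories n = (\<lambda>h. map h [1..<Suc n]) ` space (Hist n)"

lemma observations_in_histories: "\<omega> \<in> space Samp \<Longrightarrow> observations p \<omega> n \<in> histories n"
  unfolding histories_def observations_eq_obs_vector
  using measurable_space [OF measurable_obs_vector] by blast

lemma select_histories: "ys \<in> histories n \<Longrightarrow> select p ys \<in> sensors M"
  unfolding histories_def by (elim imageE) (simp only: select_hist_in_sensors)

lemma measurable_snoc:
  assumes "ys \<in> histories n" "hist_measurable (Suc n) N g"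
  shows "(\<lambda>y. g (ys @ [y])) \<in> R \<rightarrow>\<^sub>M N"
proof -
  obtain h where "h \<in> space (Hist n)" "ys = map h [1..<Suc n]"
    using assms(1) unfolding histories_def by (rule imageE)
  then show ?thesis
    using measurable_compose_Pair1 [OF _ hist_measurable_snoc [OF assms(2)]] by simp
qed

lemma law_cong: "(\<And>ys. ys \<in> histories n \<Longrightarrow> f ys = g ys) \<Longrightarrow> law i n f = law i n g"
  unfolding law_def using sets_eq_imp_space_eq [OF sets_sample_law]
  by (intro nn_integral_cong) (auto intro: observations_in_histories)

lemma law_mono: "(\<And>ys. ys \<in> histories n \<Longrightarrow> f ys \<le> g ys) \<Longrightarrow> law i n f \<le> law i n g"
  unfolding law_def using sets_eq_imp_space_eq [OF sets_sample_law]
  by (intro nn_integral_mono) (auto intro: observations_in_histories)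

lemma law_add:
  assumes "hist_measurable n borel f" "hist_measurable n borel g"
  shows "law i n (\<lambda>ys. f ys + g ys) = law i n f + law i n g"
  unfolding law_def using assms
  by (intro nn_integral_add) (auto simp: measurable_sample_law measurable_observations)

lemma law_cmult:
  "hist_measurable n borel f \<Longrightarrow> law i n (\<lambda>ys. c * f ys) = c * law i n f"
  unfolding law_def
  by (intro nn_integral_cmult) (auto simp: measurable_sample_law measurable_observations)

text \<open>\<open>cum_llr\<close> as a function of the observed list alone: the sensor behind each
  entry is recovered from the prefix before it.\<close>

definition hist_llr :: "'a list \<Rightarrow> ereal" where
  "hist_llr ys = (\<Sum>k<length ys. llr M (select p (take k ys)) (ys ! k))"

lemma hist_llr_Nil [simp]: "hist_llr [] = 0"
  by (simp add: hist_llr_def)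

lemma hist_llr_snoc: "hist_llr (ys @ [y]) = hist_llr ys + llr M (select p ys) y"
  by (simp add: hist_llr_def nth_append)

lemma cum_llr_eq_hist_llr: "cum_llr M p \<omega> n = hist_llr (observations p \<omega> n)"
proof (induction n)
  case (Suc n)
  then show ?case
    by (simp add: cum_llr_def hist_llr_snoc sensor_at_def sample_at_def)
qed (simp add: cum_llr_def)

lemma hist_measurable_hist_llr: "hist_measurable n borel hist_llr"
proof -
  have *: "(\<lambda>h. llr M (select p (take k (map h [1..<Suc n]))) (map h [1..<Suc n] ! k)) \<in> borel_measurable (Hist n)"
    if k: "k < n" for k
  proof -
    have sel: "(\<lambda>h. select p (take k (map h [1..<Suc n]))) \<in> Hist n \<rightarrow>\<^sub>M count_space (sensors M)"
      using hist_measurable_take [OF hist_measurable_select, of k n] k by (simp add: hist_measurable_def)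
    have nth: "map h [1..<Suc n] ! k = h (Suc k)" for h :: "nat \<Rightarrow> 'a"
      using k by (simp del: upt_Suc)
    have "(\<lambda>h. h (Suc k)) \<in> Hist n \<rightarrow>\<^sub>M R"
      using k by (intro measurable_component_singleton) auto
    then have "(\<lambda>h. llr M l (h (Suc k))) \<in> borel_measurable (Hist n)" if "l \<in> sensors M" for l
      by (rule measurable_compose [OF _ measurable_llr [OF that]])
    then show ?thesis
      unfolding nth by (rule measurable_compose_countable' [OF _ sel]) (auto intro: countable_finite)
  qed
  have "(\<lambda>h. \<Sum>k<n. llr M (select p (take k (map h [1..<Suc n]))) (map h [1..<Suc n] ! k)) \<in> borel_measurable (Hist n)"
    using * by (intro borel_measurable_ereal_sum) auto
  then show ?thesis
    by (simp add: hist_measurable_def hist_llr_def del: upt_Suc)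
qed

end

section \<open>Posterior and predictive expectations for a fixed prior\<close>

locale bayes_testing = procedure_testing +
  fixes x :: real
  assumes x_nonneg: "0 \<le> x" and x_le_1: "x \<le> 1"
begin

definition post :: "'a list \<Rightarrow> real" where
  "post ys = posterior x (hist_llr ys)"

lemma post_bounds: "0 \<le> post ys" "post ys \<le> 1"
  unfolding post_def by (auto intro: posterior_bounds x_nonneg x_le_1)

lemma post_Nil [simp]: "post [] = x"
  by (simp add: post_def)

lemma hist_measurable_post: "hist_measurable n borel post"
  using hist_measurable_hist_llr unfolding hist_measurable_def post_def by measurable

lemma post_snoc:
  assumes "select p ys \<in> sensors M" "y \<in> space R" "pred_dens (post ys) (select p ys) y \<noteq> 0"
  shows "post (ys @ [y]) = posterior (post ys) (llr M (select p ys) y)"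
  using assms posterior_add_llr [OF assms(1,2) x_nonneg x_le_1] by (simp add: post_def hist_llr_snoc)

definition joint :: "nat \<Rightarrow> ('a list \<Rightarrow> ennreal) \<Rightarrow> ennreal" where
  "joint n g = ennreal (1 - x) * law False n g + ennreal x * law True n g"

text \<open>The counterpart of \<open>step\<close> in which the hypothesis is averaged out under the
  current posterior.\<close>

definition predict :: "('a list \<Rightarrow> ennreal) \<Rightarrow> 'a list \<Rightarrow> ennreal" where
  "predict g ys = (\<integral>\<^sup>+ y. ennreal (pred_dens (post ys) (select p ys) y) * g (ys @ [y]) \<partial>R)"

lemma joint_cong: "(\<And>ys. ys \<in> histories n \<Longrightarrow> f ys = g ys) \<Longrightarrow> joint n f = joint n g"
  unfolding joint_def by (simp add: law_cong [of n f g])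

lemma joint_mono: "(\<And>ys. ys \<in> histories n \<Longrightarrow> f ys \<le> g ys) \<Longrightarrow> joint n f \<le> joint n g"
  unfolding joint_def by (intro add_mono mult_left_mono law_mono) auto

lemma joint_add:
  "\<lbrakk>hist_measurable n borel f; hist_measurable n borel g\<rbrakk>
    \<Longrightarrow> joint n (\<lambda>ys. f ys + g ys) = joint n f + joint n g"
  unfolding joint_def by (simp add: law_add distrib_left ac_simps)

lemma joint_cmult:
  "hist_measurable n borel f \<Longrightarrow> joint n (\<lambda>ys. c * f ys) = c * joint n f"
  unfolding joint_def by (simp add: law_cmult distrib_left ac_simps)

lemma joint_0: "joint 0 g = g []"
proof -
  have "joint 0 g = (ennreal (1 - x) + ennreal x) * g []"
    by (simp add: joint_def law_0 distrib_right)
  also have "ennreal (1 - x) + ennreal x = 1"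
    using x_nonneg x_le_1 by (simp flip: ennreal_plus)
  finally show ?thesis
    by simp
qed

lemma hist_measurable_mult_post:
  assumes "hist_measurable n borel G"
  shows "hist_measurable n borel (\<lambda>ys. ennreal (post ys) * G ys)"
    and "hist_measurable n borel (\<lambda>ys. ennreal (1 - post ys) * G ys)"
  using assms hist_measurable_post [of n] unfolding hist_measurable_def by measurable

text \<open>The assumption \<open>bayes\<close> is Bayes' rule at time \<open>n\<close>. It stays an
  assumption because this recursion is used inside the induction that proves
  \<open>bayes_rule\<close>; \<open>joint_Suc\<close> discharges it afterwards.\<close>

lemma joint_Suc_aux:
  assumes g: "hist_measurable (Suc n) borel g"
    and bayes: "\<And>G. hist_measurable n borel G \<Longrightarrow>
        ennreal x * law True n G = joint n (\<lambda>ys. ennreal (post ys) * G ys) \<and>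
        ennreal (1 - x) * law False n G = joint n (\<lambda>ys. ennreal (1 - post ys) * G ys)"
  shows "joint (Suc n) g = joint n (predict g)"
proof -
  note st = hist_measurable_step [OF g]
  have "joint (Suc n) g = joint n (\<lambda>ys. ennreal (1 - post ys) * step False g ys)
      + joint n (\<lambda>ys. ennreal (post ys) * step True g ys)"
    using bayes [OF st] by (simp add: joint_def [of "Suc n"] law_Suc [OF g])
  also have "\<dots> = joint n (\<lambda>ys. ennreal (1 - post ys) * step False g ys + ennreal (post ys) * step True g ys)"
    by (intro joint_add [symmetric] hist_measurable_mult_post st)
  also have "\<dots> = joint n (predict g)"
  proof (intro joint_cong)
    fix ys assume ys: "ys \<in> histories n"
    note [measurable] = measurable_snoc [OF ys g]
    have l [measurable]: "select p ys \<in> sensors M"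
      by (rule select_histories [OF ys])
    have "ennreal (1 - post ys) * step False g ys + ennreal (post ys) * step True g ys =
      (\<integral>\<^sup>+ y. ennreal (1 - post ys) * (ennreal (dens M False (select p ys) y) * g (ys @ [y])) +
        ennreal (post ys) * (ennreal (dens M True (select p ys) y) * g (ys @ [y])) \<partial>R)"
      unfolding step_def by (simp add: nn_integral_add nn_integral_cmult)
    also have "\<dots> = predict g ys"
      unfolding predict_def
      using l post_bounds [of ys]
      by (intro nn_integral_cong)
        (simp add: pred_dens_def dens_nonneg ennreal_mult distrib_right mult.assoc)
    finally show "ennreal (1 - post ys) * step False g ys + ennreal (post ys) * step True g ys = predict g ys" .
  qed
  finally show ?thesis .
qed

text \<open>Induction on \<open>n\<close>. Averaging the new posterior over the next sample under
  the predictive density gives the old posterior times an average under one hypothesis, so both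
  sides reduce to time \<open>n\<close> with \<open>G\<close> replaced by
  \<open>step\<close>.\<close>

lemma bayes_rule:
  assumes "hist_measurable n borel G"
  shows "ennreal x * law True n G = joint n (\<lambda>ys. ennreal (post ys) * G ys)"
    and "ennreal (1 - x) * law False n G = joint n (\<lambda>ys. ennreal (1 - post ys) * G ys)"
proof -
  have "ennreal x * law True n G = joint n (\<lambda>ys. ennreal (post ys) * G ys) \<and>
      ennreal (1 - x) * law False n G = joint n (\<lambda>ys. ennreal (1 - post ys) * G ys)"
    using assms
  proof (induction n arbitrary: G)
    case 0
    show ?case
      by (simp add: joint_0 law_0)
  next
    case (Suc n)
    note st = hist_measurable_step [OF Suc.prems]
    have aux: "joint (Suc n) g = joint n (predict g)" if "hist_measurable (Suc n) borel g" for g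
      by (rule joint_Suc_aux [OF that]) (rule Suc.IH)
    have "predict (\<lambda>ys. ennreal (post ys) * G ys) ys = ennreal (post ys) * step True G ys \<and>
        predict (\<lambda>ys. ennreal (1 - post ys) * G ys) ys = ennreal (1 - post ys) * step False G ys"
      if ys: "ys \<in> histories n" for ys
    proof -
      note [measurable] = measurable_snoc [OF ys Suc.prems]
      have l [measurable]: "select p ys \<in> sensors M"
        by (rule select_histories [OF ys])
      \<comment> \<open>Where the predictive density is zero, \<open>post_snoc\<close> gives no
        information, but then the right-hand sides vanish as well.\<close>
      have eq: "pred_dens (post ys) (select p ys) y * post (ys @ [y]) = post ys * dens M True (select p ys) y"
          "pred_dens (post ys) (select p ys) y * (1 - post (ys @ [y])) = (1 - post ys) * dens M False (select p ys) y"
        if y: "y \<in> space R" for y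
        using posterior_llr_times_pred_dens [OF l y post_bounds [of ys]] post_snoc [OF l y]
        by (cases "pred_dens (post ys) (select p ys) y = 0"; simp add: mult.commute; fail)+
      have "predict (\<lambda>ys. ennreal (post ys) * G ys) ys =
          (\<integral>\<^sup>+ y. ennreal (post ys) * (ennreal (dens M True (select p ys) y) * G (ys @ [y])) \<partial>R)"
        unfolding predict_def
      proof (intro nn_integral_cong)
        fix y assume y: "y \<in> space R"
        have "ennreal (pred_dens (post ys) (select p ys) y) * ennreal (post (ys @ [y])) =
            ennreal (post ys) * ennreal (dens M True (select p ys) y)"
          using eq(1) [OF y] l y by (simp add: post_bounds pred_dens_nonneg dens_nonneg flip: ennreal_mult)
        then show "ennreal (pred_dens (post ys) (select p ys) y) * (ennreal (post (ys @ [y])) * G (ys @ [y])) =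
            ennreal (post ys) * (ennreal (dens M True (select p ys) y) * G (ys @ [y]))"
          by (simp add: mult.assoc [symmetric])
      qed
      moreover have "predict (\<lambda>ys. ennreal (1 - post ys) * G ys) ys =
          (\<integral>\<^sup>+ y. ennreal (1 - post ys) * (ennreal (dens M False (select p ys) y) * G (ys @ [y])) \<partial>R)"
        unfolding predict_def
      proof (intro nn_integral_cong)
        fix y assume y: "y \<in> space R"
        have "ennreal (pred_dens (post ys) (select p ys) y) * ennreal (1 - post (ys @ [y])) =
            ennreal (1 - post ys) * ennreal (dens M False (select p ys) y)"
          using eq(2) [OF y] l y by (simp add: post_bounds pred_dens_nonneg dens_nonneg flip: ennreal_mult)
        then show "ennreal (pred_dens (post ys) (select p ys) y) * (ennreal (1 - post (ys @ [y])) * G (ys @ [y])) =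
            ennreal (1 - post ys) * (ennreal (dens M False (select p ys) y) * G (ys @ [y]))"
          by (simp add: mult.assoc [symmetric])
      qed
      ultimately show ?thesis
        by (simp add: step_def nn_integral_cmult)
    qed
    then have eq1: "joint n (predict (\<lambda>ys. ennreal (post ys) * G ys)) = joint n (\<lambda>ys. ennreal (post ys) * step True G ys)"
      and eq2: "joint n (predict (\<lambda>ys. ennreal (1 - post ys) * G ys)) = joint n (\<lambda>ys. ennreal (1 - post ys) * step False G ys)"
      by (auto intro: joint_cong)
    show ?case
      unfolding law_Suc [OF Suc.prems] aux [OF hist_measurable_mult_post(1) [OF Suc.prems]]
        aux [OF hist_measurable_mult_post(2) [OF Suc.prems]] eq1 eq2
      using Suc.IH [OF st [of True]] Suc.IH [OF st [of False]] by blast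
  qed
  then show "ennreal x * law True n G = joint n (\<lambda>ys. ennreal (post ys) * G ys)"
    and "ennreal (1 - x) * law False n G = joint n (\<lambda>ys. ennreal (1 - post ys) * G ys)"
    by auto
qed

lemma joint_Suc: "hist_measurable (Suc n) borel g \<Longrightarrow> joint (Suc n) g = joint n (predict g)"
  using bayes_rule by (intro joint_Suc_aux) auto

end

section \<open>Verification of solutions of the Bellman equation\<close>

context sensor_testing
begin

lemma stop_cost_nonneg: "\<lbrakk>0 \<le> x; x \<le> 1\<rbrakk> \<Longrightarrow> 0 \<le> stop_cost M x"
  using mu_nonneg by (simp add: stop_cost_def)

lemma stop_cost_le_mu1: "\<lbrakk>0 \<le> x; x \<le> 1\<rbrakk> \<Longrightarrow> stop_cost M x \<le> mu1 M"
  using mu_nonneg by (auto simp: stop_cost_def min_le_iff_disj intro: mult_left_le)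

text \<open>A solution is known to be measurable only on [0, 1], while the integrals ask for a Borel
  function on the whole line.\<close>

lemma bellman_solution_extension:
  assumes "bellman_solution M v"
  shows "(\<lambda>q. v q * indicator {0..1} q) \<in> borel_measurable borel"
  using assms borel_measurable_restrict_space_iff_ennreal [of "{0..1}" borel v]
  unfolding bellman_solution_def by simp

lemma nn_integral_joint_law:
  assumes x: "0 \<le> x" "x \<le> 1"
    and f: "f \<in> borel_measurable (count_space UNIV \<Otimes>\<^sub>M Samp)"
  shows "(\<integral>\<^sup>+ z. f z \<partial>joint_law M x) =
    ennreal (1 - x) * (\<integral>\<^sup>+ w. f (False, w) \<partial>sample_law M False) +
    ennreal x * (\<integral>\<^sup>+ w. f (True, w) \<partial>sample_law M True)"
proof -
  let ?B = "count_space UNIV \<Otimes>\<^sub>M Samp :: (bool \<times> (nat \<times> nat \<Rightarrow> 'a)) measure"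
  let ?N = "\<lambda>i. distr (sample_law M i) ?B (\<lambda>\<omega>. (i, \<omega>))"
  have pair: "(\<lambda>\<omega>. (i, \<omega>)) \<in> sample_law M i \<rightarrow>\<^sub>M ?B" for i :: bool
    unfolding measurable_sample_law by measurable
  have "prob_space (?N i)" for i
    by (rule prob_space.prob_space_distr [OF prob_space_sample_law pair])
  then have "?N i \<in> space (subprob_algebra ?B)" for i
    by (simp add: prob_space_imp_subprob_space space_subprob_algebra)
  then have N: "?N \<in> measure_pmf (bernoulli_pmf x) \<rightarrow>\<^sub>M subprob_algebra ?B"
    by (auto simp: measurable_def)
  have "(\<integral>\<^sup>+ z. f z \<partial>joint_law M x) = (\<integral>\<^sup>+ i. \<integral>\<^sup>+ z. f z \<partial>?N i \<partial>measure_pmf (bernoulli_pmf x))"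
    unfolding joint_law_def by (rule nn_integral_bind [OF f N])
  also have "\<dots> = (\<integral>\<^sup>+ i. \<integral>\<^sup>+ w. f (i, w) \<partial>sample_law M i \<partial>measure_pmf (bernoulli_pmf x))"
    using f by (simp add: nn_integral_distr [OF pair])
  finally show ?thesis
    using x by (simp add: mult.commute add.commute)
qed

end

section \<open>The cost of a procedure as a series of stage costs\<close>

context procedure_testing
begin

text \<open>The stopping time itself still counts as running, so that the penalty is charged
  there.\<close>

definition running :: "'a list \<Rightarrow> bool" where
  "running ys \<longleftrightarrow> (\<forall>k<length ys. \<not> stop p (take k ys))"

text \<open>The price of a sample is charged one time unit earlier, when its sensor is selected.
  Thus every term depends on the history of its own time only.\<close>

definition incurred :: "bool \<Rightarrow> 'a list \<Rightarrow> ennreal" where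
  "incurred i ys =
     (if \<not> running ys then 0
      else if stop p ys then
        ennreal (mu0 M * of_bool (decide p ys \<and> \<not> i) + mu1 M * of_bool (\<not> decide p ys \<and> i))
      else ennreal (usage_cost M (select p ys)))"

lemma running_Nil [simp]: "running []"
  by (simp add: running_def)

lemma running_snoc: "running (ys @ [y]) \<longleftrightarrow> running ys \<and> \<not> stop p ys"
  by (auto simp: running_def less_Suc_eq)

lemma running_observations: "running (observations p \<omega> n) \<longleftrightarrow> (\<forall>k<n. \<not> stop p (observations p \<omega> k))"
  by (auto simp: running_def take_observations)

lemma hist_measurable_not:
  assumes "hist_measurable n (count_space UNIV) P"
  shows "hist_measurable n (count_space UNIV) (\<lambda>ys. \<not> P ys)"
  using assms unfolding hist_measurable_def by measurable

lemma hist_measurable_running: "hist_measurable n (count_space UNIV) running"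
proof -
  have eq: "running (map h [1..<Suc n]) \<longleftrightarrow> (\<forall>k\<in>{..<n}. \<not> stop p (take k (map h [1..<Suc n])))" for h
    unfolding running_def by (simp only: length_map length_upt diff_Suc_1 Ball_def lessThan_iff)
  show ?thesis
    unfolding hist_measurable_def eq
  proof (rule pred_intros_finite(3))
    fix k assume "k \<in> {..<n}"
    then have "k \<le> n"
      by simp
    from hist_measurable_not [OF hist_measurable_take [OF hist_measurable_stop this]]
    show "(\<lambda>h. \<not> stop p (take k (map h [1..<Suc n]))) \<in> Hist n \<rightarrow>\<^sub>M count_space UNIV"
      unfolding hist_measurable_def .
  qed simp
qed

lemma hist_measurable_usage_cost: "hist_measurable n borel (\<lambda>ys. ennreal (usage_cost M (select p ys)))"
  unfolding hist_measurable_def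
  by (rule measurable_compose [OF hist_measurable_select [unfolded hist_measurable_def]]) simp

lemma hist_measurable_If:
  assumes "hist_measurable n (count_space UNIV) P" "hist_measurable n N f" "hist_measurable n N g"
  shows "hist_measurable n N (\<lambda>ys. if P ys then f ys else g ys)"
  using assms unfolding hist_measurable_def by measurable

lemma hist_measurable_const: "c \<in> space N \<Longrightarrow> hist_measurable n N (\<lambda>_. c)"
  by (simp add: hist_measurable_def)

lemma hist_measurable_incurred: "hist_measurable n borel (incurred i)"
proof -
  have eq: "incurred i = (\<lambda>ys. if running ys then
      if stop p ys then
        if decide p ys then ennreal (mu0 M * of_bool (\<not> i)) else ennreal (mu1 M * of_bool i)
      else ennreal (usage_cost M (select p ys))
    else 0)"
    by (auto simp: incurred_def)
  show ?thesis
    unfolding eq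
    by (rule hist_measurable_If hist_measurable_const hist_measurable_running
        hist_measurable_stop hist_measurable_decide hist_measurable_usage_cost | simp)+
qed

text \<open>If the procedure stops at \<open>n\<close>, the terms before \<open>n\<close> are the
  usage costs, the term at \<open>n\<close> is the penalty, and the later ones vanish. If it never
  stops, every term is at least 1 and both sides are infinite.\<close>

lemma realized_cost_eq_suminf: "realized_cost M p i \<omega> = (\<Sum>k. incurred i (observations p \<omega> k))"
proof (cases "stopping_at p \<omega>")
  case (enat n)
  let ?S = "{enat t |t. stop p (observations p \<omega> t)}"
  have ne: "?S \<noteq> {}"
  proof
    assume "?S = {}"
    then have "stopping_at p \<omega> = \<infinity>"
      unfolding stopping_at_def by (simp add: Inf_enat_def)
    then show False
      using enat by simp
  qed
  have "stopping_at p \<omega> \<in> ?S"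
    unfolding stopping_at_def Inf_enat_def using ne by (auto intro: LeastI)
  then have stop: "stop p (observations p \<omega> n)"
    using enat by auto
  have before: "\<not> stop p (observations p \<omega> k)" if "k < n" for k
  proof
    assume "stop p (observations p \<omega> k)"
    then have "stopping_at p \<omega> \<le> enat k"
      unfolding stopping_at_def by (intro Inf_lower) auto
    then show False
      using enat that by simp
  qed
  define err where "err = mu0 M * of_bool (decide p (observations p \<omega> n) \<and> \<not> i) +
      mu1 M * of_bool (\<not> decide p (observations p \<omega> n) \<and> i)"
  have err: "0 \<le> err"
    using mu_nonneg by (simp add: err_def)
  have *: "incurred i (observations p \<omega> k) =
      (if k < n then ennreal (usage_cost M (sensor_at p \<omega> (Suc k))) else if k = n then ennreal err else 0)" for k
    using stop before by (auto simp: incurred_def running_observations sensor_at_def err_def)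
  have "(\<Sum>k. incurred i (observations p \<omega> k)) = (\<Sum>k<Suc n. incurred i (observations p \<omega> k))"
    by (rule suminf_finite) (auto simp: *)
  also have "\<dots> = (\<Sum>k<n. ennreal (usage_cost M (sensor_at p \<omega> (Suc k)))) + ennreal err"
    by (simp add: *)
  also have "(\<Sum>k<n. ennreal (usage_cost M (sensor_at p \<omega> (Suc k)))) =
      ennreal (\<Sum>k<n. usage_cost M (sensor_at p \<omega> (Suc k)))"
    using order_trans [OF zero_le_one one_le_usage_cost] by (intro sum_ennreal) auto
  also have "(\<Sum>k<n. usage_cost M (sensor_at p \<omega> (Suc k))) = (\<Sum>t=1..n. usage_cost M (sensor_at p \<omega> t))"
    by (rule sum.reindex_bij_witness [of _ "\<lambda>t. t - 1" Suc]) auto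
  also have "ennreal (\<Sum>t=1..n. usage_cost M (sensor_at p \<omega> t)) + ennreal err = realized_cost M p i \<omega>"
    using err order_trans [OF zero_le_one one_le_usage_cost]
    by (simp add: realized_cost_def enat err_def sum_nonneg add.assoc flip: ennreal_plus)
  finally show ?thesis ..
next
  case infinity
  have never: "\<not> stop p (observations p \<omega> k)" for k
  proof
    assume "stop p (observations p \<omega> k)"
    then have "stopping_at p \<omega> \<le> enat k"
      unfolding stopping_at_def by (intro Inf_lower) auto
    then show False
      using infinity by simp
  qed
  have "(\<Sum>k. incurred i (observations p \<omega> k)) = \<top>"
    using never one_le_usage_cost
    by (intro suminf_eq_top_if_ge_1) (auto simp: incurred_def running_observations)
  then show ?thesis
    using infinity by (simp add: realized_cost_def)
qed

lemma nn_integral_realized_cost: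
  "(\<integral>\<^sup>+ \<omega>. realized_cost M p i \<omega> \<partial>sample_law M i) = (\<Sum>k. law i k (incurred i))"
  unfolding realized_cost_eq_suminf law_def
  by (rule nn_integral_suminf) (simp add: measurable_sample_law measurable_observations hist_measurable_incurred)

lemma measurable_realized_cost:
  "(\<lambda>(i, \<omega>). realized_cost M p i \<omega>) \<in> borel_measurable (count_space UNIV \<Otimes>\<^sub>M Samp)"
proof -
  have "(\<lambda>\<omega>. realized_cost M p i \<omega>) \<in> borel_measurable Samp" for i
    unfolding realized_cost_eq_suminf
    by (intro borel_measurable_suminf_order measurable_observations hist_measurable_incurred)
  then have *: "(\<lambda>z. realized_cost M p i (snd z)) \<in> borel_measurable (count_space UNIV \<Otimes>\<^sub>M Samp)" for i
    by measurable
  show ?thesis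
    unfolding split_beta' by (rule measurable_compose_countable' [OF * measurable_fst]) auto
qed

text \<open>Neither sum depends on \<open>x\<close>, and this is the source of
  \<open>bayes_value_concave\<close>.\<close>

lemma bayes_cost_affine:
  assumes "0 \<le> x" "x \<le> 1"
  shows "bayes_cost M x p =
    ennreal (1 - x) * (\<Sum>k. law False k (incurred False)) + ennreal x * (\<Sum>k. law True k (incurred True))"
  unfolding bayes_cost_def nn_integral_joint_law [OF assms measurable_realized_cost] prod.case
    nn_integral_realized_cost ..

end

section \<open>Verification of an arbitrary solution against an arbitrary procedure\<close>

context bayes_testing
begin

text \<open>Closed form of the mean of \<open>incurred\<close> under the posterior, see
  \<open>stage_cost_eq\<close>.\<close>

definition stage_cost :: "'a list \<Rightarrow> ennreal" where
  "stage_cost ys =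
     (if \<not> running ys then 0
      else if stop p ys then ennreal (if decide p ys then mu0 M * (1 - post ys) else mu1 M * post ys)
      else ennreal (usage_cost M (select p ys)))"

lemma stage_cost_eq: "stage_cost ys = ennreal (1 - post ys) * incurred False ys + ennreal (post ys) * incurred True ys"
proof -
  have "ennreal (1 - post ys) + ennreal (post ys) = 1"
    using post_bounds [of ys] by (simp flip: ennreal_plus)
  then have "ennreal (1 - post ys) * c + ennreal (post ys) * c = c" for c
    by (metis distrib_right mult_1)
  then show ?thesis
    using post_bounds [of ys] mu_nonneg
    by (auto simp: stage_cost_def incurred_def ennreal_mult mult.commute [of _ "ennreal (mu0 M)"] mult.commute [of _ "ennreal (mu1 M)"])
qed

lemma hist_measurable_stage_cost: "hist_measurable n borel stage_cost"
  using hist_measurable_mult_post [OF hist_measurable_incurred, of n]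
  unfolding stage_cost_eq [abs_def] hist_measurable_def by measurable

lemma bayes_cost_eq_suminf: "bayes_cost M x p = (\<Sum>k. joint k stage_cost)"
proof -
  have "joint k stage_cost = ennreal (1 - x) * law False k (incurred False) + ennreal x * law True k (incurred True)" for k
    unfolding stage_cost_eq [abs_def] bayes_rule [OF hist_measurable_incurred]
    by (intro joint_add hist_measurable_mult_post hist_measurable_incurred)
  then show ?thesis
    by (simp add: bayes_cost_affine x_nonneg x_le_1 suminf_add [symmetric])
qed

context
  fixes v
  assumes v: "bellman_solution M v"
begin

lemma bellman_le_stop: "\<lbrakk>0 \<le> q; q \<le> 1\<rbrakk> \<Longrightarrow> v q \<le> ennreal (stop_cost M q)"
  using v by (simp add: bellman_solution_def)

lemma bellman_le_continue: "\<lbrakk>0 \<le> q; q \<le> 1; l \<in> sensors M\<rbrakk> \<Longrightarrow> v q \<le> continue_cost M v q l"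
  using v by (simp add: bellman_solution_def min_le_iff_disj Min_le_iff)

definition ext_value :: "real \<Rightarrow> ennreal" where
  "ext_value q = v q * indicator {0..1} q"

lemma measurable_ext_value [measurable]: "ext_value \<in> borel_measurable borel"
  unfolding ext_value_def [abs_def] by (rule bellman_solution_extension [OF v])

lemma ext_value_eq: "0 \<le> q \<Longrightarrow> q \<le> 1 \<Longrightarrow> ext_value q = v q"
  by (simp add: ext_value_def)

definition pending :: "'a list \<Rightarrow> ennreal" where
  "pending ys = (if running ys then ext_value (post ys) else 0)"

definition future :: "'a list \<Rightarrow> ennreal" where
  "future ys = (\<integral>\<^sup>+ y. ennreal (pred_dens (post ys) (select p ys) y) *
     ext_value (posterior (post ys) (llr M (select p ys) y)) \<partial>R)"

lemma hist_measurable_pending: "hist_measurable n borel pending"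
proof -
  have "hist_measurable n borel (\<lambda>ys. ext_value (post ys))"
    using hist_measurable_post [of n] unfolding hist_measurable_def by measurable
  then show ?thesis
    unfolding pending_def [abs_def]
    by (intro hist_measurable_If hist_measurable_running hist_measurable_const) auto
qed

lemma predict_pending:
  assumes "ys \<in> histories n"
  shows "predict pending ys = (if running ys \<and> \<not> stop p ys then future ys else 0)"
proof -
  have l: "select p ys \<in> sensors M"
    by (rule select_histories [OF assms])
  have "ennreal (pred_dens (post ys) (select p ys) y) * ext_value (post (ys @ [y])) =
      ennreal (pred_dens (post ys) (select p ys) y) * ext_value (posterior (post ys) (llr M (select p ys) y))"
    if "y \<in> space R" for y
    using post_snoc [OF l that] by (cases "pred_dens (post ys) (select p ys) y = 0") auto
  then show ?thesis
    by (auto simp: predict_def pending_def future_def running_snoc cong: nn_integral_cong)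
qed

lemma continue_cost_future:
  assumes "ys \<in> histories n"
  shows "continue_cost M v (post ys) (select p ys) = ennreal (usage_cost M (select p ys)) + future ys"
proof -
  have "continue_cost M v (post ys) (select p ys) = continue_cost M ext_value (post ys) (select p ys)"
    by (rule continue_cost_cong [OF post_bounds]) (simp add: ext_value_eq)
  then show ?thesis
    using select_histories [OF assms] by (simp add: continue_cost_eq post_bounds future_def)
qed

text \<open>The submartingale inequality of the verification: each branch of the minimum in the
  Bellman equation bounds the value, so the bound holds whichever action the procedure
  takes.\<close>

lemma pending_le:
  assumes "ys \<in> histories n"
  shows "pending ys \<le> stage_cost ys + predict pending ys"
proof -
  have "ennreal (stop_cost M (post ys)) \<le>
      ennreal (if decide p ys then mu0 M * (1 - post ys) else mu1 M * post ys)"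
    by (intro ennreal_leI) (auto simp: stop_cost_def)
  then show ?thesis
    using bellman_le_stop [OF post_bounds [of ys]]
      bellman_le_continue [OF post_bounds [of ys] select_histories [OF assms]]
    by (auto simp: pending_def stage_cost_def predict_pending [OF assms] ext_value_eq post_bounds
        continue_cost_future [OF assms])
qed

text \<open>The factor \<open>mu1\<close> bounds every solution, by \<open>stop_cost_le_mu1\<close>.
  If the procedure goes on, then \<open>stage_cost\<close> is at least 1; otherwise nothing is
  pending at the next time.\<close>

lemma predict_pending_le:
  assumes ys: "ys \<in> histories n"
  shows "predict pending ys \<le> ennreal (mu1 M) * stage_cost ys"
proof (cases "running ys \<and> \<not> stop p ys")
  case True
  have l: "select p ys \<in> sensors M"
    by (rule select_histories [OF ys])
  have "ext_value q \<le> ennreal (mu1 M)" for q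
    using order_trans [OF bellman_le_stop ennreal_leI [OF stop_cost_le_mu1], of q]
    by (auto simp: ext_value_def indicator_def)
  then have "future ys \<le> (\<integral>\<^sup>+ y. ennreal (pred_dens (post ys) (select p ys) y) * ennreal (mu1 M) \<partial>R)"
    unfolding future_def by (intro nn_integral_mono mult_left_mono) auto
  also have "\<dots> = ennreal (mu1 M)"
    using l nn_integral_pred_dens [OF l post_bounds [of ys]]
    by (subst nn_integral_multc) (auto simp: pred_dens_def)
  also have "\<dots> \<le> ennreal (mu1 M) * stage_cost ys"
    using True one_le_usage_cost mult_left_mono [of 1 "stage_cost ys" "ennreal (mu1 M)"]
    by (simp add: stage_cost_def)
  finally show ?thesis
    using True by (simp add: predict_pending [OF ys])
qed (auto simp: predict_pending [OF ys])

lemma hist_measurable_predict_pending: "hist_measurable n borel (predict pending)"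
proof -
  have l [measurable]: "(\<lambda>(h, y). pred_dens (post (map h [1..<Suc n])) (select p (map h [1..<Suc n])) y)
      \<in> borel_measurable (Hist n \<Otimes>\<^sub>M R)"
    using measurable_dens_select [of True n] measurable_dens_select [of False n] hist_measurable_post [of n]
    unfolding pred_dens_def hist_measurable_def by measurable
  show ?thesis
    using hist_measurable_snoc [OF hist_measurable_pending, of n] l
    unfolding hist_measurable_def predict_def by measurable
qed

lemma joint_pending_le: "joint n pending \<le> joint n stage_cost + joint (Suc n) pending"
proof -
  have "joint n pending \<le> joint n (\<lambda>ys. stage_cost ys + predict pending ys)"
    by (rule joint_mono) (rule pending_le)
  also have "\<dots> = joint n stage_cost + joint (Suc n) pending"
    by (simp add: joint_add hist_measurable_stage_cost hist_measurable_predict_pending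
        joint_Suc [OF hist_measurable_pending])
  finally show ?thesis .
qed

lemma joint_pending_0: "joint 0 pending = v x"
  by (simp add: joint_0 pending_def ext_value_eq x_nonneg x_le_1)

lemma value_le_partial: "v x \<le> (\<Sum>k<n. joint k stage_cost) + joint n pending"
proof (induction n)
  case 0
  show ?case
    by (simp add: joint_pending_0)
next
  case (Suc n)
  note Suc
  also have "(\<Sum>k<n. joint k stage_cost) + joint n pending \<le>
      (\<Sum>k<n. joint k stage_cost) + (joint n stage_cost + joint (Suc n) pending)"
    by (intro add_left_mono joint_pending_le)
  finally show ?case
    by (simp add: add.assoc)
qed

lemma bellman_solution_le_bayes_cost: "v x \<le> bayes_cost M x p"
proof (cases "bayes_cost M x p = \<top>")
  case False
  define S where "S = (\<lambda>n. \<Sum>k<n. joint k stage_cost)"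
  have S: "S \<longlonglongrightarrow> bayes_cost M x p"
    using summable_LIMSEQ [of "\<lambda>k. joint k stage_cost"] by (simp add: bayes_cost_eq_suminf S_def)
  have S_Suc: "(\<lambda>n. S (Suc n)) \<longlonglongrightarrow> bayes_cost M x p"
    using S by (rule LIMSEQ_Suc)
  have "S n \<le> bayes_cost M x p" for n
    unfolding S_def bayes_cost_eq_suminf by (intro sum_le_suminf) auto
  then have "S n \<noteq> \<top>" for n
    using False by (metis top.extremum_uniqueI)
  \<comment> \<open>The stage costs are consecutive differences of convergent partial sums and tend
    to 0. Finiteness of the sums is what makes subtraction in \<open>ennreal\<close>
    faithful.\<close>
  then have "joint n stage_cost = S (Suc n) - S n" for n
    by (simp add: S_def)
  then have "(\<lambda>n. joint n stage_cost) \<longlonglongrightarrow> bayes_cost M x p - bayes_cost M x p"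
    using tendsto_diff_ennreal [OF S_Suc S] False by simp
  then have "(\<lambda>n. S (Suc n) + ennreal (mu1 M) * joint n stage_cost) \<longlonglongrightarrow>
      bayes_cost M x p + ennreal (mu1 M) * (bayes_cost M x p - bayes_cost M x p)"
    by (intro tendsto_add S_Suc ennreal_tendsto_cmult) auto
  then have lim: "(\<lambda>n. S (Suc n) + ennreal (mu1 M) * joint n stage_cost) \<longlonglongrightarrow> bayes_cost M x p"
    using False by (simp add: ennreal_diff_self)
  \<comment> \<open>The remainder at time \<open>Suc n\<close> is dominated by the stage cost at
    time \<open>n\<close>.\<close>
  have "v x \<le> S (Suc n) + ennreal (mu1 M) * joint n stage_cost" for n
  proof -
    have "joint (Suc n) pending = joint n (predict pending)"
      by (rule joint_Suc [OF hist_measurable_pending])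
    also have "\<dots> \<le> joint n (\<lambda>ys. ennreal (mu1 M) * stage_cost ys)"
      by (rule joint_mono) (rule predict_pending_le)
    also have "\<dots> = ennreal (mu1 M) * joint n stage_cost"
      by (rule joint_cmult [OF hist_measurable_stage_cost])
    finally show ?thesis
      using order_trans [OF value_le_partial [of "Suc n"] add_left_mono] by (simp add: S_def)
  qed
  with lim show ?thesis
    by (intro LIMSEQ_le_const) auto
qed simp

text \<open>The two conditions turn \<open>pending_le\<close> into an equality on all histories, so
  partial cost plus remainder is constantly \<open>v x\<close>. Dropping the nonnegative remainder
  bounds every partial sum.\<close>

lemma bayes_cost_greedy:
  assumes stop: "\<And>n ys. \<lbrakk>ys \<in> histories n; running ys; stop p ys\<rbrakk> \<Longrightarrow>
        v (post ys) = ennreal (if decide p ys then mu0 M * (1 - post ys) else mu1 M * post ys)"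
    and continue: "\<And>n ys. \<lbrakk>ys \<in> histories n; running ys; \<not> stop p ys\<rbrakk> \<Longrightarrow>
        v (post ys) = continue_cost M v (post ys) (select p ys)"
  shows "bayes_cost M x p \<le> v x"
proof -
  have "pending ys = stage_cost ys + predict pending ys" if "ys \<in> histories n" for n ys
    using stop [OF that] continue [OF that]
    by (auto simp: pending_def stage_cost_def predict_pending [OF that] ext_value_eq post_bounds
        continue_cost_future [OF that])
  then have *: "joint n pending = joint n stage_cost + joint (Suc n) pending" for n
    by (simp add: joint_Suc [OF hist_measurable_pending] joint_cong [of n pending] joint_add
        hist_measurable_stage_cost hist_measurable_predict_pending)
  have "v x = (\<Sum>k<n. joint k stage_cost) + joint n pending" for n
  proof (induction n)
    case (Suc n)
    then show ?case
      using * [of n] by (simp add: add.assoc)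
  qed (simp add: joint_pending_0)
  then have "(\<Sum>k<n. joint k stage_cost) \<le> v x" for n
    by (metis le_iff_add)
  then show ?thesis
    unfolding bayes_cost_eq_suminf by (intro suminf_le_const) auto
qed

end

end

section \<open>Value iteration\<close>

lemma tendsto_Min:
  fixes f :: "'i \<Rightarrow> 'b \<Rightarrow> 'c::linorder_topology"
  assumes "finite A" "A \<noteq> {}" "\<And>a. a \<in> A \<Longrightarrow> (f a \<longlongrightarrow> l a) F"
  shows "((\<lambda>x. MIN a\<in>A. f a x) \<longlongrightarrow> (MIN a\<in>A. l a)) F"
  using assms
proof (induction A rule: finite_ne_induct)
  case (insert a A)
  then show ?case
    by (simp add: tendsto_min)
qed simp

context sensor_testing
begin

lemma measurable_continue_cost:
  assumes v [measurable]: "v \<in> borel_measurable borel" and l [measurable]: "l \<in> sensors M"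
  shows "(\<lambda>q. continue_cost M v q l) \<in> borel_measurable borel"
  unfolding continue_cost_eq [OF l v] pred_dens_def by measurable

definition bellman_op :: "(real \<Rightarrow> ennreal) \<Rightarrow> real \<Rightarrow> ennreal" where
  "bellman_op v q = min (ennreal (stop_cost M q)) (MIN l\<in>sensors M. continue_cost M v q l)"

lemma measurable_bellman_op:
  assumes "v \<in> borel_measurable borel"
  shows "bellman_op v \<in> borel_measurable borel"
  unfolding bellman_op_def [abs_def] stop_cost_def using measurable_continue_cost [OF assms]
  by (intro borel_measurable_min borel_measurable_Min) auto

lemma continue_cost_mono: "(\<And>q. v q \<le> w q) \<Longrightarrow> continue_cost M v q l \<le> continue_cost M w q l"
  unfolding continue_cost_def by (intro add_left_mono nn_integral_mono) auto

lemma bellman_op_mono: "(\<And>q. v q \<le> w q) \<Longrightarrow> bellman_op v q \<le> bellman_op w q"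
  unfolding bellman_op_def
  by (intro min.mono order_refl) (auto simp: Min_le_iff intro: continue_cost_mono)

primrec value_iter :: "nat \<Rightarrow> real \<Rightarrow> ennreal" where
  "value_iter 0 = (\<lambda>_. 0)"
| "value_iter (Suc n) = bellman_op (value_iter n)"

lemma measurable_value_iter [measurable]: "value_iter n \<in> borel_measurable borel"
  by (induction n) (auto intro: measurable_bellman_op)

lemma value_iter_le_Suc: "value_iter n q \<le> value_iter (Suc n) q"
proof (induction n arbitrary: q)
  case (Suc n)
  then show ?case
    by (simp add: bellman_op_mono)
qed simp

lemma incseq_value_iter: "incseq (\<lambda>n. value_iter n q)"
  by (intro incseq_SucI value_iter_le_Suc)

definition value_limit :: "real \<Rightarrow> ennreal" where
  "value_limit q = (SUP n. value_iter n q)"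

lemma measurable_value_limit [measurable]: "value_limit \<in> borel_measurable borel"
  unfolding value_limit_def [abs_def] by measurable

text \<open>Monotone convergence: the iterates started at 0 increase, so the limit passes through
  the integral.\<close>

lemma continue_cost_value_limit:
  assumes l [measurable]: "l \<in> sensors M"
  shows "(\<lambda>n. continue_cost M (value_iter n) q l) \<longlonglongrightarrow> continue_cost M value_limit q l"
proof -
  let ?f = "\<lambda>n y. ennreal (pred_dens q l y) * value_iter n (posterior q (llr M l y))"
  have inc: "incseq (\<lambda>n. \<integral>\<^sup>+ y. ?f n y \<partial>R)"
    by (intro incseq_SucI nn_integral_mono mult_left_mono value_iter_le_Suc) auto
  have "(\<integral>\<^sup>+ y. ennreal (pred_dens q l y) * value_limit (posterior q (llr M l y)) \<partial>R) = (\<integral>\<^sup>+ y. (SUP n. ?f n y) \<partial>R)"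
    by (simp add: value_limit_def SUP_mult_left_ennreal)
  also have "\<dots> = (SUP n. \<integral>\<^sup>+ y. ?f n y \<partial>R)"
  proof (rule nn_integral_monotone_convergence_SUP)
    show "incseq ?f"
      by (intro incseq_SucI le_funI mult_left_mono value_iter_le_Suc) auto
    show "?f n \<in> borel_measurable R" for n
      unfolding pred_dens_def by measurable
  qed
  finally have "(\<lambda>n. \<integral>\<^sup>+ y. ?f n y \<partial>R) \<longlonglongrightarrow>
      (\<integral>\<^sup>+ y. ennreal (pred_dens q l y) * value_limit (posterior q (llr M l y)) \<partial>R)"
    using LIMSEQ_SUP [OF inc] by simp
  then show ?thesis
    by (simp add: continue_cost_eq [OF l] tendsto_add)
qed

text \<open>The shifted iterates converge to both sides, since the minimum over finitely many
  sensors is continuous.\<close>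

lemma bellman_op_value_limit: "bellman_op value_limit q = value_limit q"
proof (rule LIMSEQ_unique)
  show "(\<lambda>n. value_iter (Suc n) q) \<longlonglongrightarrow> bellman_op value_limit q"
    by (simp add: bellman_op_def tendsto_min tendsto_Min continue_cost_value_limit)
  show "(\<lambda>n. value_iter (Suc n) q) \<longlonglongrightarrow> value_limit q"
    unfolding value_limit_def by (intro LIMSEQ_Suc LIMSEQ_SUP incseq_value_iter)
qed

lemma bellman_solution_value_limit: "bellman_solution M value_limit"
  using bellman_op_value_limit
  by (auto simp: bellman_solution_def bellman_op_def intro: measurable_restrict_space1)

lemma bellman_solution_cong:
  assumes v: "bellman_solution M v" and eq: "\<And>q. 0 \<le> q \<Longrightarrow> q \<le> 1 \<Longrightarrow> w q = v q"
  shows "bellman_solution M w"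
proof -
  have "w \<in> borel_measurable (restrict_space borel {0..1}) \<longleftrightarrow> v \<in> borel_measurable (restrict_space borel {0..1})"
    by (intro measurable_cong) (auto simp: space_restrict_space eq)
  moreover have "continue_cost M w q l = continue_cost M v q l" if "0 \<le> q" "q \<le> 1" for q l
    by (rule continue_cost_cong [OF that eq])
  ultimately show ?thesis
    using v eq unfolding bellman_solution_def by simp
qed

text \<open>The smallest minimising index is a measurable choice: \<open>P l\<close> compares
  finitely many Borel functions, and \<open>LEAST\<close> over the naturals preserves
  measurability.\<close>

lemma measurable_argmin_selection:
  assumes v: "bellman_solution M v" and x: "0 \<le> x" "x \<le> 1"
  obtains \<psi> where "\<psi> \<in> borel \<rightarrow>\<^sub>M count_space (sensors M)"
    and "\<And>r. is_arg_min (continue_cost M v (posterior x r)) (\<lambda>l. l \<in> sensors M) (\<psi> r)"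
proof
  define c where "c = (\<lambda>l r. continue_cost M v (posterior x r) l)"
  define P where "P = (\<lambda>l r. l \<in> sensors M \<and> (\<forall>m\<in>sensors M. c l r \<le> c m r))"
  define \<psi> where "\<psi> = (\<lambda>r. LEAST l. P l r)"
  have c [measurable]: "c l \<in> borel_measurable borel" if l: "l \<in> sensors M" for l
  proof -
    have "c l = (\<lambda>r. continue_cost M (\<lambda>q. v q * indicator {0..1} q) (posterior x r) l)"
      unfolding c_def by (intro ext continue_cost_cong posterior_bounds x) simp
    then show ?thesis
      using measurable_compose [OF _ measurable_continue_cost [OF bellman_solution_extension [OF v] l], of "posterior x" borel]
      by simp
  qed
  have "Measurable.pred borel (P l)" for l
  proof (cases "l \<in> sensors M")
    case True
    then show ?thesis
      unfolding P_def [abs_def] by measurable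
  qed (simp add: P_def)
  then have meas: "\<psi> \<in> borel \<rightarrow>\<^sub>M count_space UNIV"
    unfolding \<psi>_def by (rule measurable_Least)
  have P: "P (\<psi> r) r" for r
  proof -
    obtain l where "l \<in> sensors M" "\<forall>m\<in>sensors M. c l r \<le> c m r"
      using arg_min_if_finite [of "sensors M" "\<lambda>l. c l r"] by (meson finite_sensors not_less sensors_nonempty)
    then have "P l r"
      by (simp add: P_def)
    then show ?thesis
      unfolding \<psi>_def by (rule LeastI)
  qed
  show "\<psi> \<in> borel \<rightarrow>\<^sub>M count_space (sensors M)"
    unfolding measurable_count_space_eq2 [OF finite_sensors]
    using P measurable_sets [OF meas] by (auto simp: P_def)
  show "is_arg_min (continue_cost M v (posterior x r)) (\<lambda>l. l \<in> sensors M) (\<psi> r)" for r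
    using P [of r] by (auto simp: is_arg_min_def P_def c_def not_less)
qed
end

section \<open>Stationary procedures\<close>

context sensor_testing
begin

text \<open>Selections depend on the running sum, and the sum on past selections. The fold computes
  the sum from the observations alone, so a procedure can be defined from it without
  circularity.\<close>

definition stationary_llr :: "(ereal \<Rightarrow> nat) \<Rightarrow> 'a list \<Rightarrow> ereal" where
  "stationary_llr \<psi> = foldl (\<lambda>L y. L + llr M (\<psi> L) y) 0"

definition stationary_procedure ::
  "(ereal \<Rightarrow> nat) \<Rightarrow> (ereal \<Rightarrow> bool) \<Rightarrow> (ereal \<Rightarrow> bool) \<Rightarrow> 'a procedure" where
  "stationary_procedure \<psi> \<sigma> \<delta> =
     \<lparr>select = (\<lambda>ys. \<psi> (stationary_llr \<psi> ys)), stop = (\<lambda>ys. \<sigma> (stationary_llr \<psi> ys)),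
      decide = (\<lambda>ys. \<delta> (stationary_llr \<psi> ys))\<rparr>"

lemma stationary_procedure_sel [simp]:
  "select (stationary_procedure \<psi> \<sigma> \<delta>) ys = \<psi> (stationary_llr \<psi> ys)"
  "stop (stationary_procedure \<psi> \<sigma> \<delta>) ys = \<sigma> (stationary_llr \<psi> ys)"
  "decide (stationary_procedure \<psi> \<sigma> \<delta>) ys = \<delta> (stationary_llr \<psi> ys)"
  by (simp_all add: stationary_procedure_def)

lemma stationary_llr_Nil [simp]: "stationary_llr \<psi> [] = 0"
  by (simp add: stationary_llr_def)

lemma stationary_llr_snoc:
  "stationary_llr \<psi> (ys @ [y]) = stationary_llr \<psi> ys + llr M (\<psi> (stationary_llr \<psi> ys)) y"
  by (simp add: stationary_llr_def)

lemma hist_measurable_stationary_llr: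
  assumes \<psi>: "\<psi> \<in> borel \<rightarrow>\<^sub>M count_space (sensors M)"
  shows "hist_measurable n borel (stationary_llr \<psi>)"
proof (induction n)
  case 0
  show ?case
    by (simp add: hist_measurable_def)
next
  case (Suc n)
  have split: "map h [1..<Suc (Suc n)] = map h [1..<Suc n] @ [h (Suc n)]" for h :: "nat \<Rightarrow> 'a"
    by simp
  have "take n (map h [1..<Suc (Suc n)]) = map h [1..<Suc n]" for h :: "nat \<Rightarrow> 'a"
    unfolding split by simp
  then have L: "(\<lambda>h. stationary_llr \<psi> (map h [1..<Suc n])) \<in> borel_measurable (Hist (Suc n))"
    using hist_measurable_take [OF Suc, of "Suc n"] by (simp add: hist_measurable_def del: upt_Suc)
  have comp: "(\<lambda>h. h (Suc n)) \<in> Hist (Suc n) \<rightarrow>\<^sub>M R"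
    by (rule measurable_component_singleton) simp
  have "(\<lambda>h. llr M l (h (Suc n))) \<in> borel_measurable (Hist (Suc n))" if "l \<in> sensors M" for l
    by (rule measurable_compose [OF comp measurable_llr [OF that]])
  then have "(\<lambda>h. llr M (\<psi> (stationary_llr \<psi> (map h [1..<Suc n]))) (h (Suc n))) \<in> borel_measurable (Hist (Suc n))"
    by (rule measurable_compose_countable' [OF _ measurable_compose [OF L \<psi>]]) (auto intro: countable_finite)
  with L show ?case
    unfolding hist_measurable_def split stationary_llr_snoc by (rule borel_measurable_ereal_add)
qed

lemma stationary_procedure_in_procedures:
  assumes "\<psi> \<in> borel \<rightarrow>\<^sub>M count_space (sensors M)" "Measurable.pred borel \<sigma>" "Measurable.pred borel \<delta>"
  shows "stationary_procedure \<psi> \<sigma> \<delta> \<in> procedures M"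
  unfolding procedures_def mem_Collect_eq stationary_procedure_sel
  using hist_measurable_stationary_llr [OF assms(1), unfolded hist_measurable_def]
  by (intro allI conjI) (rule measurable_compose, assumption, rule assms)+

lemma hist_llr_stationary_procedure:
  assumes "stationary_procedure \<psi> \<sigma> \<delta> \<in> procedures M"
  shows "procedure_testing.hist_llr M (stationary_procedure \<psi> \<sigma> \<delta>) ys = stationary_llr \<psi> ys"
proof -
  interpret procedure_testing M "stationary_procedure \<psi> \<sigma> \<delta>"
    by unfold_locales (rule assms)
  show ?thesis
    by (induction ys rule: rev_induct) (simp_all add: hist_llr_snoc stationary_llr_snoc)
qed

text \<open>
  The rules \<open>\<sigma>\<close>, \<open>\<delta>\<close> and \<open>\<psi>\<close> need to be optimal only at log-likelihood ratios that the procedure can reach.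
\<close>

lemma bayes_cost_stationary_procedure:
  assumes v: "bellman_solution M v" and x: "0 \<le> x" "x \<le> 1"
    and proc: "stationary_procedure \<psi> \<sigma> \<delta> \<in> procedures M"
    and stop: "\<And>r. \<lbrakk>\<sigma> r; r = 0 \<or> \<not> \<sigma> 0\<rbrakk> \<Longrightarrow> v (posterior x r) =
        ennreal (if \<delta> r then mu0 M * (1 - posterior x r) else mu1 M * posterior x r)"
    and continue: "\<And>r. \<lbrakk>\<not> \<sigma> r; \<not> \<sigma> 0\<rbrakk> \<Longrightarrow> v (posterior x r) = continue_cost M v (posterior x r) (\<psi> r)"
  shows "bayes_cost M x (stationary_procedure \<psi> \<sigma> \<delta>) = v x"
proof -
  let ?p = "stationary_procedure \<psi> \<sigma> \<delta>"
  interpret bayes_testing M ?p x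
    by unfold_locales (use proc x in auto)
  have post: "post ys = posterior x (stationary_llr \<psi> ys)" for ys
    by (simp add: post_def hist_llr_stationary_procedure [OF proc])
  \<comment> \<open>If the procedure stops at time 0, then only the empty history is
    running.\<close>
  have initial: "ys = [] \<or> \<not> \<sigma> 0" if "running ys" for ys
    using that unfolding running_def by (cases ys) force+
  have "bayes_cost M x ?p \<le> v x"
  proof (rule bayes_cost_greedy [OF v])
    fix n ys assume "running ys" "stop ?p ys"
    then show "v (post ys) = ennreal (if decide ?p ys then mu0 M * (1 - post ys) else mu1 M * post ys)"
      using stop [of "stationary_llr \<psi> ys"] initial [of ys] by (auto simp: post)
  next
    fix n ys assume "running ys" "\<not> stop ?p ys"
    then show "v (post ys) = continue_cost M v (post ys) (select ?p ys)"
      using continue [of "stationary_llr \<psi> ys"] initial [of ys] by (auto simp: post)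
  qed
  then show ?thesis
    using bellman_solution_le_bayes_cost [OF v] by (rule antisym)
qed

text \<open>Verification bounds \<open>v x\<close> by the cost of every procedure, and
  \<open>v\<close> itself supplies a procedure of cost \<open>v x\<close>. That procedure is phrased
  through the posterior; thresholds have to wait for concavity.\<close>

lemma bellman_solution_unique:
  assumes v: "bellman_solution M v" and x: "0 \<le> x" "x \<le> 1"
  shows "v x = bayes_value M x"
proof (rule antisym)
  show "v x \<le> bayes_value M x"
    unfolding bayes_value_def
  proof (rule INF_greatest)
    fix p assume p: "p \<in> procedures M"
    interpret bayes_testing M p x
      by unfold_locales (use p x in auto)
    show "v x \<le> bayes_cost M x p"
      by (rule bellman_solution_le_bayes_cost [OF v])
  qed
  obtain \<psi> where \<psi>: "\<psi> \<in> borel \<rightarrow>\<^sub>M count_space (sensors M)"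
    and argmin: "\<And>r. is_arg_min (continue_cost M v (posterior x r)) (\<lambda>l. l \<in> sensors M) (\<psi> r)"
    using measurable_argmin_selection [OF v x] by blast
  \<comment> \<open>Ties are resolved in favour of stopping, and \<open>\<delta>\<close> picks the
    decision with the smaller expected penalty.\<close>
  define \<sigma> where "\<sigma> r \<longleftrightarrow> ennreal (stop_cost M (posterior x r)) \<le> v (posterior x r)" for r
  define \<delta> where "\<delta> r \<longleftrightarrow> mu0 M * (1 - posterior x r) \<le> mu1 M * posterior x r" for r
  have "v (posterior x r) = v (posterior x r) * indicator {0..1} (posterior x r)" for r
    using posterior_bounds [OF x, of r] by simp
  then have [measurable]: "(\<lambda>r. v (posterior x r)) \<in> borel_measurable borel"
    using measurable_compose [OF _ bellman_solution_extension [OF v], of "posterior x" borel]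
    by simp
  have "Measurable.pred borel \<sigma>" "Measurable.pred borel \<delta>"
    unfolding \<sigma>_def [abs_def] \<delta>_def [abs_def] stop_cost_def by measurable
  then have proc: "stationary_procedure \<psi> \<sigma> \<delta> \<in> procedures M"
    by (rule stationary_procedure_in_procedures [OF \<psi>])
  have eq: "v (posterior x r) = min (ennreal (stop_cost M (posterior x r)))
      (MIN l\<in>sensors M. continue_cost M v (posterior x r) l)" for r
    using v posterior_bounds [OF x, of r] by (simp add: bellman_solution_def)
  have "bayes_cost M x (stationary_procedure \<psi> \<sigma> \<delta>) = v x"
  proof (rule bayes_cost_stationary_procedure [OF v x proc])
    fix r assume "\<sigma> r"
    then have "v (posterior x r) = ennreal (stop_cost M (posterior x r))"
      using eq [of r] unfolding \<sigma>_def by (metis antisym min.cobounded1)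
    also have "stop_cost M (posterior x r) =
        (if \<delta> r then mu0 M * (1 - posterior x r) else mu1 M * posterior x r)"
      by (auto simp: stop_cost_def \<delta>_def min_def)
    finally show "v (posterior x r) =
        ennreal (if \<delta> r then mu0 M * (1 - posterior x r) else mu1 M * posterior x r)" .
  next
    fix r assume "\<not> \<sigma> r"
    then have "v (posterior x r) = (MIN l\<in>sensors M. continue_cost M v (posterior x r) l)"
      using eq [of r] unfolding \<sigma>_def by (auto simp: min_def split: if_splits)
    also have "\<dots> = continue_cost M v (posterior x r) (\<psi> r)"
      using argmin [of r] by (intro Min_eqI) (auto simp: is_arg_min_def not_less)
    finally show "v (posterior x r) = continue_cost M v (posterior x r) (\<psi> r)" .
  qed
  then show "bayes_value M x \<le> v x"
    unfolding bayes_value_def using proc by (metis INF_lower)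
qed

lemma bellman_solution_bayes_value: "bellman_solution M (bayes_value M)"
  by (rule bellman_solution_cong [OF bellman_solution_value_limit])
    (simp add: bellman_solution_unique [OF bellman_solution_value_limit])

end

section \<open>Concavity and the continuation interval\<close>

lemma open_interval_eq_Inf_Sup:
  fixes C :: "real set"
  assumes "open C" and C: "C \<noteq> {}" "bdd_below C" "bdd_above C"
    and conv: "\<And>r s u. \<lbrakk>r \<in> C; u \<in> C; r < s; s < u\<rbrakk> \<Longrightarrow> s \<in> C"
  shows "C = {Inf C<..<Sup C}"
proof (intro equalityI subsetI)
  fix r assume "r \<in> C"
  then obtain e where e: "0 < e" "ball r e \<subseteq> C"
    using \<open>open C\<close> open_contains_ball by blast
  have "r - e / 2 \<in> C" "r + e / 2 \<in> C"
    using e by (auto intro!: subsetD [OF e(2)] simp: dist_real_def)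
  then have "Inf C \<le> r - e / 2" "r + e / 2 \<le> Sup C"
    using C by (auto intro: cInf_lower cSup_upper)
  then show "r \<in> {Inf C<..<Sup C}"
    using e by simp
next
  fix r assume "r \<in> {Inf C<..<Sup C}"
  then obtain s u where "s \<in> C" "s < r" "u \<in> C" "r < u"
    using C by (auto simp: cInf_less_iff less_cSup_iff)
  then show "r \<in> C"
    using conv by blast
qed

lemma posterior_strict_mono:
  assumes "0 < x" "x < 1" "r < s"
  shows "posterior x (ereal r) < posterior x (ereal s)"
proof -
  have "0 < 1 - x + x * exp r" "0 < 1 - x + x * exp s"
    using assms by (auto intro: posterior_denominator_pos)
  moreover have "x * exp r * (1 - x) < x * exp s * (1 - x)"
    using assms by simp
  ultimately show ?thesis
    by (simp add: divide_simps) (simp add: algebra_simps)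
qed

lemma posterior_in_open_unit:
  assumes "0 < x" "x < 1"
  shows "0 < posterior x (ereal r)" "posterior x (ereal r) < 1"
proof -
  have "0 < 1 - x + x * exp r"
    using assms by (auto intro: posterior_denominator_pos)
  then show "0 < posterior x (ereal r)" "posterior x (ereal r) < 1"
    using assms by (auto simp: divide_simps)
qed

text \<open>Exponential decay of the error probabilities in the log-likelihood ratio, obtained by
  dropping one summand of the denominator. It bounds the continuation set on either side.\<close>

lemma posterior_le_exp:
  assumes "0 < x" "x < 1"
  shows "posterior x (ereal r) \<le> x * exp r / (1 - x)"
    and "1 - posterior x (ereal r) \<le> (1 - x) * exp (- r) / x"
proof -
  have pos: "0 < 1 - x + x * exp r"
    using assms by (auto intro: posterior_denominator_pos)
  show "posterior x (ereal r) \<le> x * exp r / (1 - x)"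
    using assms by (simp add: frac_le)
  have "1 - posterior x (ereal r) = (1 - x) / (1 - x + x * exp r)"
    using pos by (simp add: field_simps)
  also have "\<dots> \<le> (1 - x) / (x * exp r)"
    using assms by (intro frac_le) auto
  also have "\<dots> = (1 - x) * exp (- r) / x"
    by (simp add: exp_minus field_simps)
  finally show "1 - posterior x (ereal r) \<le> (1 - x) * exp (- r) / x" .
qed

text \<open>The chord from 0 shows that \<open>w q / q\<close> is nonincreasing, the chord from 1
  that \<open>w q / (1 - q)\<close> is nondecreasing. Both are cleared of denominators so as to
  include the endpoints.\<close>

lemma concave_on_unit_chord:
  fixes w :: "real \<Rightarrow> real"
  assumes w: "concave_on {0..1} w" and nonneg: "0 \<le> w 0" "0 \<le> w 1"
    and q: "0 \<le> q" "q \<le> q'" "q' \<le> 1"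
  shows "w q' * q \<le> w q * q'" and "w q * (1 - q') \<le> w q' * (1 - q)"
proof -
  show "w q' * q \<le> w q * q'"
  proof (cases "q' = 0")
    case False
    define t where "t = q / q'"
    have t: "0 \<le> t" "t \<le> 1" and qt: "q = t * q'"
      using q False by (auto simp: t_def divide_simps)
    have "t * w q' \<le> (1 - t) * w 0 + t * w q'"
      using t nonneg by simp
    also have "\<dots> \<le> w ((1 - t) *\<^sub>R 0 + t *\<^sub>R q')"
      using t q by (intro concave_onD [OF w]) auto
    finally have "t * w q' \<le> w q"
      by (simp add: qt)
    then have "t * w q' * q' \<le> w q * q'"
      using q by (intro mult_right_mono) auto
    then show ?thesis
      by (simp add: qt mult.commute mult.left_commute)
  qed (use q in simp)
  show "w q * (1 - q') \<le> w q' * (1 - q)"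
  proof (cases "q = 1")
    case False
    \<comment> \<open>Here \<open>q'\<close> lies between \<open>q\<close> and 1, and
      \<open>t\<close> is its weight on \<open>q\<close>.\<close>
    define t where "t = (1 - q') / (1 - q)"
    have t: "0 \<le> t" "t \<le> 1" and qt: "1 - q' = t * (1 - q)"
      using q False by (auto simp: t_def divide_simps)
    have "t * w q \<le> (1 - t) * w 1 + t * w q"
      using t nonneg by simp
    also have "\<dots> \<le> w ((1 - t) *\<^sub>R 1 + t *\<^sub>R q)"
      using t q by (intro concave_onD [OF w]) auto
    also have "(1 - t) *\<^sub>R 1 + t *\<^sub>R q = q'"
      using qt by (simp add: algebra_simps)
    finally have "t * w q * (1 - q) \<le> w q' * (1 - q)"
      using q by (intro mult_right_mono) auto
    then show ?thesis
      by (simp add: qt mult.commute mult.left_commute)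
  qed (use q in simp)
qed

context sensor_testing
begin

text \<open>Real-valued copy for the arguments on concavity and continuity. On [0, 1] the value is
  finite, being at most \<open>stop_cost\<close>.\<close>

definition value_fun :: "real \<Rightarrow> real" where
  "value_fun q = enn2real (bayes_value M q)"

lemma bayes_value_le_stop: "\<lbrakk>0 \<le> q; q \<le> 1\<rbrakk> \<Longrightarrow> bayes_value M q \<le> ennreal (stop_cost M q)"
  using bellman_solution_bayes_value by (simp add: bellman_solution_def)

lemma bayes_value_eq: "\<lbrakk>0 \<le> q; q \<le> 1\<rbrakk> \<Longrightarrow> bayes_value M q = ennreal (value_fun q)"
  unfolding value_fun_def using bayes_value_le_stop [of q]
  by (metis ennreal_enn2real ennreal_less_top le_less_trans)

lemma value_fun_nonneg: "0 \<le> value_fun q"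
  by (simp add: value_fun_def)

lemma value_fun_le_stop: "\<lbrakk>0 \<le> q; q \<le> 1\<rbrakk> \<Longrightarrow> value_fun q \<le> stop_cost M q"
  using bayes_value_le_stop [of q] by (simp add: bayes_value_eq stop_cost_nonneg)

lemma bayes_value_concave:
  assumes "0 \<le> a" "a \<le> 1" "0 \<le> b" "b \<le> 1" "0 \<le> t" "t \<le> 1"
  shows "ennreal (1 - t) * bayes_value M a + ennreal t * bayes_value M b \<le> bayes_value M ((1 - t) * a + t * b)"
  unfolding bayes_value_def [of _ "(1 - t) * a + t * b"]
proof (rule INF_greatest)
  fix p assume p: "p \<in> procedures M"
  interpret procedure_testing M p
    by unfold_locales (rule p)
  define c where "c = (\<lambda>i. \<Sum>k. law i k (incurred i))"
  define z where "z = (1 - t) * a + t * b"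
  have z: "0 \<le> z" "z \<le> 1"
    using assms convex_bound_le [of a 1 b "1 - t" t] by (auto simp: z_def)
  have w1: "ennreal (1 - t) * ennreal (1 - a) + ennreal t * ennreal (1 - b) = ennreal (1 - z)"
    using assms unfolding z_def
    by (simp flip: ennreal_mult ennreal_plus) (simp add: algebra_simps)
  have w2: "ennreal (1 - t) * ennreal a + ennreal t * ennreal b = ennreal z"
    using assms by (simp add: z_def flip: ennreal_mult ennreal_plus)
  have "ennreal (1 - t) * bayes_value M a + ennreal t * bayes_value M b \<le>
      ennreal (1 - t) * bayes_cost M a p + ennreal t * bayes_cost M b p"
    unfolding bayes_value_def by (intro add_mono mult_left_mono INF_lower p) auto
  also have "\<dots> = (ennreal (1 - t) * ennreal (1 - a) + ennreal t * ennreal (1 - b)) * c False +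
      (ennreal (1 - t) * ennreal a + ennreal t * ennreal b) * c True"
    using assms by (simp add: bayes_cost_affine c_def distrib_left distrib_right ac_simps)
  also have "\<dots> = bayes_cost M z p"
    unfolding w1 w2 using z by (simp add: bayes_cost_affine c_def)
  finally show "ennreal (1 - t) * bayes_value M a + ennreal t * bayes_value M b \<le> bayes_cost M ((1 - t) * a + t * b) p"
    by (simp add: z_def)
qed

lemma concave_value_fun: "concave_on {0..1} value_fun"
proof (unfold concave_on_iff, intro conjI ballI allI impI)
  show "convex {0..1::real}"
    by simp
  fix a b u t :: real
  assume ab: "a \<in> {0..1}" "b \<in> {0..1}" and ut: "0 \<le> u" "0 \<le> t" "u + t = 1"
  have u: "u = 1 - t"
    using ut by simp
  define z where "z = (1 - t) * a + t * b"
  have z: "0 \<le> z" "z \<le> 1"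
    using ab ut convex_bound_le [of a 1 b "1 - t" t] by (auto simp: z_def)
  have "ennreal ((1 - t) * value_fun a + t * value_fun b) \<le> ennreal (value_fun z)"
    using bayes_value_concave [of a b t] ab ut z
    by (simp add: bayes_value_eq value_fun_nonneg ennreal_plus ennreal_mult flip: z_def)
  then show "u * value_fun a + t * value_fun b \<le> value_fun (u *\<^sub>R a + t *\<^sub>R b)"
    using value_fun_nonneg [of z] by (simp add: u z_def ennreal_le_iff)
qed

lemma stop_cost_ge_1:
  assumes "0 \<le> q" "q \<le> 1" "value_fun q < stop_cost M q"
  shows "1 \<le> stop_cost M q"
proof -
  have "bayes_value M q < ennreal (stop_cost M q)"
    using assms by (simp add: bayes_value_eq value_fun_nonneg ennreal_less_iff)
  then have "(MIN l\<in>sensors M. continue_cost M (bayes_value M) q l) < ennreal (stop_cost M q)"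
    using bellman_solution_bayes_value assms by (auto simp: bellman_solution_def min_less_iff_disj)
  then obtain l where "l \<in> sensors M" "continue_cost M (bayes_value M) q l < ennreal (stop_cost M q)"
    by (auto simp: Min_less_iff)
  moreover have "1 \<le> continue_cost M (bayes_value M) q l"
  proof -
    have "ennreal 1 \<le> ennreal (usage_cost M l)"
      by (intro ennreal_leI one_le_usage_cost)
    then show ?thesis
      unfolding continue_cost_def using order_trans [OF _ le_add1] by (simp add: add_increasing2)
  qed
  ultimately have "ennreal 1 \<le> ennreal (stop_cost M q)"
    unfolding ennreal_1 by (meson less_imp_le order_trans)
  then show ?thesis
    using stop_cost_nonneg [OF assms(1,2)] ennreal_le_iff by blast
qed

lemma continuation_set_eq:
  assumes "0 \<le> x" "x \<le> 1"
  shows "continuation_set M x (bayes_value M) =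
    {r. value_fun (posterior x (ereal r)) < stop_cost M (posterior x (ereal r))}"
  unfolding continuation_set_def
  using posterior_bounds [OF assms]
  by (simp add: bayes_value_eq value_fun_nonneg ennreal_less_iff del: posterior.simps)

text \<open>A prior of 0 or 1 is not revised by a finite log-likelihood ratio, and there
  \<open>stop_cost\<close> is 0, so no value can lie below it.\<close>

lemma prior_in_open_unit:
  assumes x: "0 \<le> x" "x \<le> 1" and ne: "continuation_set M x (bayes_value M) \<noteq> {}"
  shows "0 < x" "x < 1"
proof -
  have "False" if "x = 0 \<or> x = 1"
  proof -
    have "stop_cost M (posterior x (ereal r)) = 0" for r
      using that mu_nonneg by (auto simp: stop_cost_def)
    then show False
      using ne value_fun_nonneg by (auto simp: continuation_set_eq [OF x] not_less[symmetric])
  qed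
  then show "0 < x" "x < 1"
    using x by fastforce+
qed

text \<open>
  Each of the two lines of \<open>stop_cost\<close> vanishes at an endpoint of \<open>[0, 1]\<close>, where the concave value
  function is nonnegative. If the two meet at some point, then the value function stays above the line
  between that endpoint and the point.
\<close>

lemma stop_cost_below_continuation:
  assumes q: "0 \<le> q" "q < q'" "q' \<le> 1" and stop: "value_fun q = stop_cost M q"
    and cont: "value_fun q' < stop_cost M q'"
  shows "mu1 M * q \<le> mu0 M * (1 - q)"
proof (rule ccontr)
  assume "\<not> ?thesis"
  then have "value_fun q = mu0 M * (1 - q)"
    using stop by (simp add: stop_cost_def)
  then have "mu0 M * (1 - q) * (1 - q') \<le> value_fun q' * (1 - q)"
    using concave_on_unit_chord(2) [OF concave_value_fun value_fun_nonneg value_fun_nonneg, of q q'] q by simp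
  then have "mu0 M * (1 - q') * (1 - q) \<le> value_fun q' * (1 - q)"
    by (simp add: ac_simps)
  then have "mu0 M * (1 - q') \<le> value_fun q'"
    using q by (simp add: mult_le_cancel_right)
  then show False
    using cont by (simp add: stop_cost_def)
qed

lemma stop_cost_above_continuation:
  assumes q: "0 \<le> q'" "q' < q" "q \<le> 1" and stop: "value_fun q = stop_cost M q"
    and cont: "value_fun q' < stop_cost M q'"
  shows "mu0 M * (1 - q) \<le> mu1 M * q"
proof (rule ccontr)
  assume "\<not> ?thesis"
  then have "value_fun q = mu1 M * q"
    using stop by (simp add: stop_cost_def)
  then have "mu1 M * q * q' \<le> value_fun q' * q"
    using concave_on_unit_chord(1) [OF concave_value_fun value_fun_nonneg value_fun_nonneg, of q' q] q by simp
  then have "mu1 M * q' * q \<le> value_fun q' * q"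
    by (simp add: ac_simps)
  then have "mu1 M * q' \<le> value_fun q'"
    using q by (simp add: mult_le_cancel_right)
  then show False
    using cont by (simp add: stop_cost_def)
qed

text \<open>Suppose that \<open>q\<close> were a stopping point. The continuation point
  \<open>q2\<close> above it forces \<open>mu1 M * q\<close> to be the active line at
  \<open>q\<close>; the chord from 0 to \<open>q\<close> then keeps the value at \<open>q1\<close>
  on or above that line, contradicting continuation at \<open>q1\<close>.\<close>

lemma value_fun_less_between:
  assumes q: "0 < q1" "q1 < q" "q < q2" "q2 < 1"
    and cont: "value_fun q1 < stop_cost M q1" "value_fun q2 < stop_cost M q2"
  shows "value_fun q < stop_cost M q"
proof (rule ccontr)
  assume "\<not> ?thesis"
  then have stop: "value_fun q = stop_cost M q"
    using value_fun_le_stop [of q] q by simp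
  have "mu1 M * q \<le> mu0 M * (1 - q)"
    using stop_cost_below_continuation [OF _ _ _ stop cont(2)] q by simp
  then have "value_fun q = mu1 M * q"
    using stop by (simp add: stop_cost_def)
  then have "mu1 M * q1 * q \<le> value_fun q1 * q"
    using concave_on_unit_chord(1) [OF concave_value_fun value_fun_nonneg value_fun_nonneg, of q1 q] q
    by (simp add: ac_simps)
  then have "mu1 M * q1 \<le> value_fun q1"
    using q by (simp add: mult_le_cancel_right)
  then show False
    using cont by (simp add: stop_cost_def)
qed

lemma continuation_set_interval:
  assumes x: "0 \<le> x" "x \<le> 1" and ne: "continuation_set M x (bayes_value M) \<noteq> {}"
  obtains A B where "- A < B" "{- A<..<B} = continuation_set M x (bayes_value M)"
proof -
  define C where "C = continuation_set M x (bayes_value M)"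
  define P where "P = (\<lambda>r. posterior x (ereal r))"
  note x' = prior_in_open_unit [OF x ne]
  have C: "r \<in> C \<longleftrightarrow> value_fun (P r) < stop_cost M (P r)" for r
    by (simp add: C_def P_def continuation_set_eq [OF x])
  have P: "0 < P r" "P r < 1" for r
    using posterior_in_open_unit [OF x'] by (auto simp: P_def)
  have contP: "continuous_on UNIV P"
  proof -
    have "1 - x + x * exp r \<noteq> 0" for r
      using posterior_denominator_pos [OF x, of "exp r"] by simp
    then show ?thesis
      unfolding P_def posterior.simps by (intro continuous_intros) auto
  qed
  \<comment> \<open>Concavity gives continuity in the interior only; for a prior in (0, 1) the
    posteriors of finite ratios stay there.\<close>
  have "continuous_on {0<..<1} value_fun"
  proof -
    have "convex_on {0<..<1} (\<lambda>q. - value_fun q)"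
      using concave_value_fun unfolding concave_on_def
      by (rule convex_on_subset) auto
    then have "continuous_on {0<..<1} (\<lambda>q. - value_fun q)"
      by (intro convex_on_continuous) auto
    then show ?thesis
      using continuous_on_minus by fastforce
  qed
  then have "continuous_on UNIV (\<lambda>r. value_fun (P r))"
    by (rule continuous_on_compose2 [OF _ contP]) (use P in auto)
  moreover have "continuous_on UNIV (\<lambda>r. stop_cost M (P r))"
    unfolding stop_cost_def by (intro continuous_intros contP)
  ultimately have "open {r. value_fun (P r) < stop_cost M (P r)}"
    by (rule open_Collect_less)
  then have "open C"
    by (simp add: C [symmetric])
  have ge1: "1 \<le> stop_cost M (P r)" if "r \<in> C" for r
    using stop_cost_ge_1 [of "P r"] P [of r] that by (simp add: C)
  \<comment> \<open>On \<open>C\<close> each line of \<open>stop_cost\<close> is at least 1, while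
    the first is at most a constant times \<open>exp r\<close>. Hence \<open>exp (- r)\<close> is
    bounded on \<open>C\<close>, and \<open>exp (- r) \<ge> 1 - r\<close> turns this into a lower
    bound for \<open>r\<close>.\<close>
  have "bdd_below C"
  proof (rule bdd_belowI)
    fix r assume "r \<in> C"
    then have "1 \<le> mu1 M * P r"
      using ge1 [of r] by (simp add: stop_cost_def)
    also have "\<dots> \<le> mu1 M * (x * exp r / (1 - x))"
      using posterior_le_exp(1) [OF x', of r] mu_nonneg unfolding P_def by (intro mult_left_mono) auto
    finally have "exp (- r) * 1 \<le> exp (- r) * (mu1 M * (x * exp r / (1 - x)))"
      by (intro mult_left_mono) auto
    also have "\<dots> = mu1 M * x / (1 - x)"
      by (simp add: exp_minus)
    finally have "exp (- r) \<le> mu1 M * x / (1 - x)"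
      by simp
    then show "- (mu1 M * x / (1 - x)) \<le> r"
      using exp_ge_add_one_self [of "- r"] by linarith
  qed
  have "bdd_above C"
  proof (rule bdd_aboveI)
    fix r assume "r \<in> C"
    then have "1 \<le> mu0 M * (1 - P r)"
      using ge1 [of r] by (simp add: stop_cost_def)
    also have "\<dots> \<le> mu0 M * ((1 - x) * exp (- r) / x)"
      using posterior_le_exp(2) [OF x', of r] mu_nonneg unfolding P_def by (intro mult_left_mono) auto
    finally have "exp r * 1 \<le> exp r * (mu0 M * ((1 - x) * exp (- r) / x))"
      by (intro mult_left_mono) auto
    also have "\<dots> = mu0 M * (1 - x) / x"
      by (simp add: exp_minus)
    finally have "exp r \<le> mu0 M * (1 - x) / x"
      by simp
    then show "r \<le> mu0 M * (1 - x) / x"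
      using exp_ge_add_one_self [of r] by linarith
  qed
  have between: "s \<in> C" if "r \<in> C" "u \<in> C" "r < s" "s < u" for r s u
  proof -
    have "P r < P s" "P s < P u"
      using posterior_strict_mono [OF x'] that by (simp_all only: P_def)
    then show ?thesis
      using value_fun_less_between [OF P(1) _ _ P(2)] that by (simp only: C)
  qed
  have eq: "C = {Inf C<..<Sup C}"
    using \<open>open C\<close> ne [folded C_def] \<open>bdd_below C\<close> \<open>bdd_above C\<close> between
    by (rule open_interval_eq_Inf_Sup)
  obtain r where "r \<in> C"
    using ne unfolding C_def by blast
  then have "r \<in> {Inf C<..<Sup C}"
    using eq by (rule subst [rotated])
  \<comment> \<open>The thresholds are \<open>A = - Inf C\<close> and
    \<open>B = Sup C\<close>.\<close>
  then have "- (- Inf C) < Sup C"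
    by simp
  moreover have "{- (- Inf C)<..<Sup C} = continuation_set M x (bayes_value M)"
    unfolding minus_minus C_def [symmetric] by (rule eq [symmetric])
  ultimately show ?thesis
    by (rule that)
qed

section \<open>Existence of a rule and optimality of the resulting sequential test\<close>

lemma bellman_rule_exists:
  assumes x: "0 \<le> x" "x \<le> 1"
  shows "\<exists>\<psi> A B. bellman_rule M x (bayes_value M) \<psi> A B"
proof -
  obtain \<psi> where \<psi>: "\<psi> \<in> borel \<rightarrow>\<^sub>M count_space (sensors M)"
    "\<And>r. is_arg_min (continue_cost M (bayes_value M) (posterior x r)) (\<lambda>l. l \<in> sensors M) (\<psi> r)"
    using measurable_argmin_selection [OF bellman_solution_bayes_value x] by blast
  show ?thesis
  proof (cases "continuation_set M x (bayes_value M) = {}")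
    case False
    with continuation_set_interval [OF x] obtain A B
      where "- A < B" "{- A<..<B} = continuation_set M x (bayes_value M)"
      by blast
    then have "bellman_rule M x (bayes_value M) \<psi> A B"
      using \<psi> False by (simp add: bellman_rule_def)
    then show ?thesis
      by blast
  next
    case True
    \<comment> \<open>The sum of log-likelihood ratios starts at 0. With \<open>A = 0\<close> and
      \<open>B = 1\<close> it starts at \<open>- A\<close>, with \<open>A = 1\<close> and
      \<open>B = 0\<close> it starts at \<open>B\<close>; the choice depends on which error is
      cheaper at the prior.\<close>
    have "bellman_rule M x (bayes_value M) \<psi> 0 1 \<or> bellman_rule M x (bayes_value M) \<psi> 1 0"
      using \<psi> True by (auto simp: bellman_rule_def)
    then show ?thesis
      by blast
  qed
qed

text \<open>At reachable ratios the test acts greedily: between the thresholds the value is below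
  the stopping cost, outside it equals the stopping cost, and the side of the exit tells which
  decision is cheaper.\<close>

lemma bellman_rule_optimal:
  assumes x: "0 \<le> x" "x \<le> 1" and rule: "bellman_rule M x (bayes_value M) \<psi> A B"
  defines "p \<equiv> stationary_procedure \<psi> (\<lambda>L. L \<notin> {ereal (- A)<..<ereal B}) (\<lambda>L. ereal B \<le> L)"
  shows "optimal_procedure M x p" "stationary_selection M p \<psi>" "sprt_stopping M p A B" "sprt_decision M p A B"
proof -
  define C where "C = continuation_set M x (bayes_value M)"
  have \<psi>: "\<psi> \<in> borel \<rightarrow>\<^sub>M count_space (sensors M)"
    and argmin: "\<And>r. is_arg_min (continue_cost M (bayes_value M) (posterior x r)) (\<lambda>l. l \<in> sensors M) (\<psi> r)"
    and AB: "- A < B"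
    using rule by (auto simp: bellman_rule_def)
  have C_AB: "C = {- A<..<B}" if "C \<noteq> {}"
    using rule that by (simp add: bellman_rule_def C_def)
  have C_empty: "0 \<le> - A \<and> mu1 M * x \<le> mu0 M * (1 - x) \<or> B \<le> 0 \<and> mu0 M * (1 - x) \<le> mu1 M * x"
    if "C = {}"
    using rule that by (simp add: bellman_rule_def C_def)
  have C_iff: "r \<in> C \<longleftrightarrow> value_fun (posterior x (ereal r)) < stop_cost M (posterior x (ereal r))" for r
    by (simp add: C_def continuation_set_eq [OF x])
  have proc: "p \<in> procedures M"
    unfolding p_def by (rule stationary_procedure_in_procedures [OF \<psi>]) measurable
  interpret procedure_testing M p
    by unfold_locales (rule proc)
  have hist: "hist_llr ys = stationary_llr \<psi> ys" for ys
    using hist_llr_stationary_procedure proc unfolding p_def by blast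
  have cum: "cum_llr M p \<omega> n = stationary_llr \<psi> (observations p \<omega> n)" for \<omega> n
    by (simp add: cum_llr_eq_hist_llr hist)
  show "stationary_selection M p \<psi>"
    unfolding stationary_selection_def cum sensor_at_def by (simp add: p_def)
  show "sprt_stopping M p A B"
    unfolding sprt_stopping_def stopping_at_def cum by (simp add: p_def)
  show "sprt_decision M p A B"
    unfolding sprt_decision_def cum
  proof (intro allI impI conjI)
    fix \<omega> n
    show "\<not> decide p (observations p \<omega> n)" if "stationary_llr \<psi> (observations p \<omega> n) \<le> ereal (- A)"
      using that AB order_trans [of "ereal B" _ "ereal (- A)"] by (force simp: p_def)
    show "decide p (observations p \<omega> n)" if "ereal B \<le> stationary_llr \<psi> (observations p \<omega> n)"
      using that by (simp add: p_def)
  qed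
  have "bayes_cost M x p = bayes_value M x"
    unfolding p_def
  proof (rule bayes_cost_stationary_procedure [OF bellman_solution_bayes_value x proc [unfolded p_def]])
    fix L :: ereal
    define q where "q = posterior x L"
    have q: "0 \<le> q" "q \<le> 1"
      using posterior_bounds [OF x] by (auto simp: q_def)
    assume out: "L \<notin> {ereal (- A)<..<ereal B}" and init: "L = 0 \<or> \<not> 0 \<notin> {ereal (- A)<..<ereal B}"
    have L: "L \<le> ereal (- A) \<or> ereal B \<le> L"
      using out by auto
    \<comment> \<open>Without a continuation set the initial ratio 0 already lies outside the
      thresholds, so no other ratio is reached.\<close>
    have init': "L = 0" if "C = {}"
      using init C_empty [OF that] by (auto simp: zero_ereal_def)
    \<comment> \<open>At an infinite ratio the posterior is 0 or 1 and stopping costs nothing, so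
      the value is 0 as well.\<close>
    have stop: "value_fun q = stop_cost M q"
    proof (cases L)
      case (real r)
      have "r \<notin> C"
        using C_AB out real by (cases "C = {}") auto
      then show ?thesis
        using value_fun_le_stop [OF q] real by (simp add: C_iff q_def)
    qed (use value_fun_le_stop [OF q] value_fun_nonneg [of q] mu_nonneg in \<open>auto simp: q_def stop_cost_def\<close>)
    have "stop_cost M q = (if ereal B \<le> L then mu0 M * (1 - q) else mu1 M * q)"
    proof (cases L)
      case (real r)
      show ?thesis
      proof (cases "C = {}")
        case True
        then have "r = 0" "q = x"
          using init' real by (auto simp: q_def zero_ereal_def)
        then show ?thesis
          using C_empty [OF True] AB real by (auto simp: stop_cost_def)
      next
        case False
        note x' = prior_in_open_unit [OF x False [unfolded C_def]]
        \<comment> \<open>The midpoint of \<open>- A\<close> and \<open>B\<close> serves as a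
          continuation point. By \<open>stop_cost_above_continuation\<close>, stopping points above
          it favour \<open>True\<close>; by \<open>stop_cost_below_continuation\<close>, those below
          it favour \<open>False\<close>.\<close>
        define s where "s = (B - A) / 2"
        have s: "s \<in> C" "- A < s" "s < B"
          using C_AB [OF False] AB by (auto simp: s_def)
        define q' where "q' = posterior x (ereal s)"
        have q': "0 \<le> q'" "q' \<le> 1" "value_fun q' < stop_cost M q'"
          using posterior_bounds [OF x] s by (auto simp: q'_def C_iff simp del: posterior.simps)
        show ?thesis
        proof (cases "B \<le> r")
          case True
          then have "q' < q"
            using posterior_strict_mono [OF x', of s r] s real by (simp add: q_def q'_def del: posterior.simps)
          then show ?thesis
            using stop_cost_above_continuation [of q' q] q q' stop True real by (simp add: stop_cost_def)
        next
          case False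
          then have "q < q'"
            using posterior_strict_mono [OF x', of r s] s L real by (simp add: q_def q'_def del: posterior.simps)
          then show ?thesis
            using stop_cost_below_continuation [of q q'] q q' stop False real by (simp add: stop_cost_def)
        qed
      qed
    qed (use mu_nonneg in \<open>auto simp: q_def stop_cost_def\<close>)
    then show "bayes_value M (posterior x L) =
        ennreal (if ereal B \<le> L then mu0 M * (1 - posterior x L) else mu1 M * posterior x L)"
      using stop q by (simp add: bayes_value_eq flip: q_def)
  next
    fix L :: ereal
    assume inside: "\<not> L \<notin> {ereal (- A)<..<ereal B}" and init: "\<not> 0 \<notin> {ereal (- A)<..<ereal B}"
    have "C \<noteq> {}"
      using C_empty init by (auto simp: zero_ereal_def)
    obtain r where L: "L = ereal r" and "r \<in> {- A<..<B}"
      using inside by (cases L) auto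
    then have "r \<in> C"
      using C_AB [OF \<open>C \<noteq> {}\<close>] by blast
    have "bayes_value M (posterior x L) < ennreal (stop_cost M (posterior x L))"
      using L \<open>r \<in> C\<close> by (simp add: C_def continuation_set_def)
    moreover have "bayes_value M (posterior x L) = min (ennreal (stop_cost M (posterior x L)))
        (MIN l\<in>sensors M. continue_cost M (bayes_value M) (posterior x L) l)"
      using bellman_solution_bayes_value posterior_bounds [OF x, of L] by (simp add: bellman_solution_def)
    ultimately have "bayes_value M (posterior x L) = (MIN l\<in>sensors M. continue_cost M (bayes_value M) (posterior x L) l)"
      unfolding min_def by (metis less_irrefl)
    also have "\<dots> = continue_cost M (bayes_value M) (posterior x L) (\<psi> L)"
      using argmin [of L] by (intro Min_eqI) (auto simp: is_arg_min_def not_less)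
    finally show "bayes_value M (posterior x L) = continue_cost M (bayes_value M) (posterior x L) (\<psi> L)" .
  qed
  then have "bayes_cost M x p \<le> bayes_cost M x q" if "q \<in> procedures M" for q
    using INF_lower [OF that, of "bayes_cost M x"] by (simp add: bayes_value_def)
  then show "optimal_procedure M x p"
    using proc unfolding optimal_procedure_def is_arg_min_def by (meson not_less)
qed

end

text \<open>Uniqueness on [0, 1] is what makes the rule computable: any solution found there has the
  values from which \<open>bellman_rule\<close> reads \<open>\<psi>\<close> and the
  thresholds.\<close>

theorem theorem2:
  fixes M :: "'a sensor_model" and \<pi>\<^sub>0 \<pi>\<^sub>1 :: real
  assumes "valid_model M"
    and "0 \<le> \<pi>\<^sub>0" and "0 \<le> \<pi>\<^sub>1" and "\<pi>\<^sub>0 + \<pi>\<^sub>1 = 1"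
  shows "bellman_solution M (bayes_value M) \<and>
    (\<forall>v. bellman_solution M v \<longrightarrow> (\<forall>x\<in>{0..1}. v x = bayes_value M x)) \<and>
    (\<exists>\<psi> A B. bellman_rule M \<pi>\<^sub>1 (bayes_value M) \<psi> A B) \<and>
    (\<forall>\<psi> A B. bellman_rule M \<pi>\<^sub>1 (bayes_value M) \<psi> A B \<longrightarrow>
      (\<exists>p. optimal_procedure M \<pi>\<^sub>1 p \<and>
        stationary_selection M p \<psi> \<and> sprt_stopping M p A B \<and> sprt_decision M p A B))"
proof -
  interpret sensor_testing M
    by unfold_locales (rule assms(1))
  have x: "0 \<le> \<pi>\<^sub>1" "\<pi>\<^sub>1 \<le> 1"
    using assms by auto
  show ?thesis
  proof (intro conjI allI impI ballI)
    show "bellman_solution M (bayes_value M)"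
      by (rule bellman_solution_bayes_value)
    show "v x = bayes_value M x" if "bellman_solution M v" "x \<in> {0..1}" for v x
      using bellman_solution_unique that by simp
    show "\<exists>\<psi> A B. bellman_rule M \<pi>\<^sub>1 (bayes_value M) \<psi> A B"
      by (rule bellman_rule_exists [OF x])
    show "\<exists>p. optimal_procedure M \<pi>\<^sub>1 p \<and>
        stationary_selection M p \<psi> \<and> sprt_stopping M p A B \<and> sprt_decision M p A B"
      if "bellman_rule M \<pi>\<^sub>1 (bayes_value M) \<psi> A B" for \<psi> A B
      using bellman_rule_optimal [OF x that] by blast
  qed
qed

end
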